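(* Let $G\in\mathcal G$ (possibly generated by a non-compact family). Then all of the following hold. 1. $(\mathcal J_G,\le)$ is totally ordered, where $\le$ is the surrounding order. 2. Each connected component of the Fatou set $F(G)$ is either simply or doubly connected. 3. For any $g\in G$ and any connected component $J$ of $J(G)$, the set $g^{-1}(J)$ is connected. Let $g^{*}(J)$ be the connected component of $J(G)$ containing $g^{-1}(J)$. If $J\in\mathcal J_G$, then $g^{*}(J)\in\mathcal J_G$. If $J_1,J_2\in\mathcal J_G$ and $J_1\le J_2$, then $g^{-1}(J_1)\le g^{-1}(J_2)$ and $g^{*}(J_1)\le g^{*}(J_2)$.
   Context: $\hat{\mathbb C}$ is the Riemann sphere. A polynomial semigroup is a semigroup $G$ (under composition) generated by a family of non-constant polynomial maps on $\hat{\mathbb C}$. The Fatou set $F(G)$ is the set of $z\in\hat{\mathbb C}$ having a neighborhood on which $G$ is a normal family, and the Julia set is $J(G)=\hat{\mathbb C}\setminus F(G)$. The postcritical set is $P(G)=\overline{\bigcup_{g\in G}\{\text{critical values of } g:\hat{\mathbb C}\to\hat{\mathbb C}\}}$ (closure in $\hat{\mathbb C}$), and $P^{*}(G)=P(G)\setminus\{\infty\}$. $\mathcal G$ is the set of all polynomial semigroups $G$ such that every element of $G$ has degree at least two and $P^{*}(G)$ is bounded in $\mathbb C$. $\mathcal J_G$ is the set of all connected components $J$ of $J(G)$ with $J\subset\mathbb C$. Surrounding order: for connected sets $K_1,K_2\subset\mathbb C$, $K_1\le K_2$ means that $K_1=K_2$ or $K_1$ is contained in a bounded component of $\mathbb C\setminus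 K_2$. This is a partial order on the non-empty compact connected subsets of $\mathbb C$. *)

theory Defs
  imports "HOL-Analysis.Analysis" "HOL-Computational_Algebra.Polynomial"
begin

section \<open>The Riemann sphere\<close>

datatype riemann_sphere = Fin complex | Infty

text \<open>Inverse stereographic projection onto the unit sphere of $C \times R = R^3$ (north pole
  \<^term>\<open>Infty\<close>). The metric below is the chordal metric it induces.\<close>

fun stereo :: "riemann_sphere \<Rightarrow> complex \<times> real" where
  "stereo (Fin z) = ((2 / (1 + (cmod z)\<^sup>2)) *\<^sub>R z, ((cmod z)\<^sup>2 - 1) / ((cmod z)\<^sup>2 + 1))"
| "stereo Infty = (0, 1)"

lemma inj_stereo: "inj stereo"
proof (rule injI)
  have pos: "1 + (cmod z)\<^sup>2 > 0" "(cmod z)\<^sup>2 + 1 > 0" for z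
    by (auto intro: add_pos_nonneg add_nonneg_pos)
  have ne1: "stereo (Fin z) \<noteq> stereo Infty" for z
    using pos(2)[of z] by (simp add: divide_eq_eq)
  have inj_Fin: "z = w" if "stereo (Fin z) = stereo (Fin w)" for z w
  proof -
    have "((cmod z)\<^sup>2 - 1) / ((cmod z)\<^sup>2 + 1) = ((cmod w)\<^sup>2 - 1) / ((cmod w)\<^sup>2 + 1)"
      using that by simp
    then have eq: "(cmod z)\<^sup>2 = (cmod w)\<^sup>2"
      using pos(2)[of z] pos(2)[of w] by (simp add: frac_eq_eq algebra_simps)
    have "(2 / (1 + (cmod z)\<^sup>2)) *\<^sub>R z = (2 / (1 + (cmod z)\<^sup>2)) *\<^sub>R w"
      using that unfolding stereo.simps prod.inject eq by blast
    then show ?thesis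
      using pos(1)[of z] by (simp add: scaleR_cancel_left)
  qed
  show "x = y" if "stereo x = stereo y" for x y
    using that inj_Fin ne1 ne1[symmetric] by (cases x; cases y) (simp_all del: stereo.simps)
qed

instantiation riemann_sphere :: metric_space
begin

definition dist_riemann_sphere :: "riemann_sphere \<Rightarrow> riemann_sphere \<Rightarrow> real" where
  "dist_riemann_sphere x y = dist (stereo x) (stereo y)"

definition uniformity_riemann_sphere :: "(riemann_sphere \<times> riemann_sphere) filter" where
  "uniformity_riemann_sphere = (INF e\<in>{0 <..}. principal {(x, y). dist x y < e})"

definition open_riemann_sphere :: "riemann_sphere set \<Rightarrow> bool" where
  "open_riemann_sphere U \<longleftrightarrow> (\<forall>x\<in>U. eventually (\<lambda>(x', y). x' = x \<longrightarrow> y \<in> U) uniformity)"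

instance
proof
  fix x y z :: riemann_sphere
  show "dist x y = 0 \<longleftrightarrow> x = y"
    by (simp add: dist_riemann_sphere_def inj_eq[OF inj_stereo])
  show "dist x y \<le> dist x z + dist y z"
    by (simp add: dist_riemann_sphere_def dist_triangle2)
qed (fact uniformity_riemann_sphere_def open_riemann_sphere_def)+

end

section \<open>Polynomial maps of the sphere\<close>

fun sphere_map :: "complex poly \<Rightarrow> riemann_sphere \<Rightarrow> riemann_sphere" where
  "sphere_map p (Fin z) = Fin (poly p z)"
| "sphere_map p Infty = (if degree p = 0 then Fin (poly p 0) else Infty)"

text \<open>The next two lemmas justify representing a set of polynomial maps of the sphere, with
  composition, by the set of the polynomials themselves, with \<^const>\<open>pcompose\<close>.\<close>

lemma inj_sphere_map: "inj sphere_map"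
proof (rule injI)
  fix p q assume "sphere_map p = sphere_map q"
  then have "sphere_map p (Fin z) = sphere_map q (Fin z)" for z by simp
  then have "poly p = poly q" by auto
  then show "p = q" by (simp add: poly_eq_poly_eq_iff)
qed

lemma sphere_map_pcompose:
  assumes "degree q > 0"
  shows "sphere_map (pcompose p q) = sphere_map p \<circ> sphere_map q"
proof
  fix x show "sphere_map (pcompose p q) x = (sphere_map p \<circ> sphere_map q) x"
  proof (cases x)
    case Infty
    show ?thesis
    proof (cases "degree p = 0")
      case True
      then obtain c where "p = [:c:]" by (rule degree_eq_zeroE)
      then show ?thesis using Infty assms by simp
    next
      case False
      then show ?thesis using Infty assms by (simp add: degree_pcompose)
    qed
  qed (simp add: poly_pcompose)
qed

inductive_set generated_semigroup :: "complex poly set \<Rightarrow> complex poly set"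
  for \<Gamma> :: "complex poly set" where
  generator: "g \<in> \<Gamma> \<Longrightarrow> g \<in> generated_semigroup \<Gamma>"
| comp: "g \<in> generated_semigroup \<Gamma> \<Longrightarrow> h \<in> generated_semigroup \<Gamma>
    \<Longrightarrow> pcompose g h \<in> generated_semigroup \<Gamma>"

definition polynomial_semigroup :: "complex poly set \<Rightarrow> bool" where
  "polynomial_semigroup G \<longleftrightarrow>
     (\<exists>\<Gamma>. (\<forall>g\<in>\<Gamma>. degree g > 0) \<and> G = generated_semigroup \<Gamma>)"

section \<open>Fatou, Julia and postcritical sets\<close>

definition normal_family_on ::
    "('a::metric_space \<Rightarrow> 'b::metric_space) set \<Rightarrow> 'a set \<Rightarrow> bool" where
  "normal_family_on \<F> U \<longleftrightarrow>
     (\<forall>f :: nat \<Rightarrow> 'a \<Rightarrow> 'b. range f \<subseteq> \<F> \<longrightarrow>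
        (\<exists>r h. strict_mono (r :: nat \<Rightarrow> nat) \<and>
          (\<forall>K. compact K \<and> K \<subseteq> U \<longrightarrow> uniform_limit K (\<lambda>n. f (r n)) h sequentially)))"

definition Fatou :: "complex poly set \<Rightarrow> riemann_sphere set" where
  "Fatou G = {z. \<exists>U. open U \<and> z \<in> U \<and> normal_family_on (sphere_map ` G) U}"

definition Julia :: "complex poly set \<Rightarrow> riemann_sphere set" where
  "Julia G = - Fatou G"

text \<open>At infinity, criticality of a non-constant polynomial map is read off in the chart
  $w = 1/z$.\<close>

definition critical_points :: "complex poly \<Rightarrow> riemann_sphere set" where
  "critical_points p =
     {Fin z | z. poly (pderiv p) z = 0} \<union>
     {x. x = Infty \<and>
       ((\<lambda>w. if w = 0 then 0 else inverse (poly p (inverse w))) has_field_derivative 0) (at 0)}"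

definition critical_values :: "complex poly \<Rightarrow> riemann_sphere set" where
  "critical_values p = sphere_map p ` critical_points p"

definition postcritical :: "complex poly set \<Rightarrow> riemann_sphere set" where
  "postcritical G = closure (\<Union>g\<in>G. critical_values g)"

definition finite_postcritical :: "complex poly set \<Rightarrow> riemann_sphere set" where
  "finite_postcritical G = postcritical G - {Infty}"

text \<open>Boundedness is meant in the plane, hence the preimage under \<^term>\<open>Fin\<close>: every subset of the
  sphere is bounded for the chordal metric.\<close>

definition postcritically_bounded :: "complex poly set \<Rightarrow> bool" where
  "postcritically_bounded G \<longleftrightarrow> bounded (Fin -` finite_postcritical G)"

definition class_G :: "complex poly set set" where
  "class_G = {G. polynomial_semigroup G \<and> (\<forall>g\<in>G. degree g \<ge> 2) \<and> postcritically_bounded G}"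

section \<open>Components of the Julia set and the surrounding order\<close>

definition Julia_components :: "complex poly set \<Rightarrow> riemann_sphere set set" where
  "Julia_components G = {J \<in> components (Julia G). J \<subseteq> range Fin}"

text \<open>Meant for connected subsets of the plane, embedded in the sphere by \<^term>\<open>Fin\<close>. The
  complement of the second set, its components and their boundedness are taken in the plane.\<close>

definition surrounding_le :: "riemann_sphere set \<Rightarrow> riemann_sphere set \<Rightarrow> bool" where
  "surrounding_le K1 K2 \<longleftrightarrow>
     K1 = K2 \<or> (\<exists>C \<in> components (- (Fin -` K2)). bounded C \<and> K1 \<subseteq> Fin ` C)"

text \<open>A domain of the sphere is doubly connected if its complement in the sphere has exactly two
  connected components.\<close>

definition doubly_connected :: "riemann_sphere set \<Rightarrow> bool" where
  "doubly_connected U \<longleftrightarrow> open U \<and> connected U \<and> card (components (- U)) = 2"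

definition pullback_component ::
    "complex poly set \<Rightarrow> complex poly \<Rightarrow> riemann_sphere set \<Rightarrow> riemann_sphere set" where
  "pullback_component G g J = (THE C. C \<in> components (Julia G) \<and> sphere_map g -` J \<subseteq> C)"

end

theory Submission
  imports Defs "HOL-Complex_Analysis.Complex_Analysis"
    "HOL-Computational_Algebra.Fundamental_Theorem_Algebra"
begin

text \<open>
  All critical values of all elements of \<open>G\<close> have modulus less than some \<open>M\<close>. Hence for \<open>f \<in> G\<close>
  and \<open>R \<ge> M\<close> the level set \<open>|f| = R\<close> is connected, and \<open>|f| < R\<close> contains every critical value of
  every element of \<open>G\<close>.

  Let \<open>J\<close> be a bounded component of the Julia set. Every neighbourhood of \<open>J\<close> contains a level set
  \<open>|f| = R\<close> with \<open>f \<in> G\<close> and \<open>R\<close> arbitrarily large: otherwise normality on the boundary of a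
  suitable neighbourhood would spread to its interior. This replaces the density of repelling fixed
  points in the Julia set. It has the following consequences.

  \<^item> No critical value lies in the unbounded component of the complement of \<open>J\<close>; two such components
    surround a common point and are therefore comparable.

  \<^item> If \<open>g\<^sup>-\<^sup>1(J)\<close> split into two closed pieces, each of them would map onto \<open>J\<close>, so for \<open>|f| = R\<close> close
    to \<open>J\<close> the connected set \<open>|f \<circ> g| = R\<close> would split as well.

  \<^item> If the component \<open>C\<close> of the Julia set containing \<open>\<infinity>\<close> had another point, it would meet
    \<open>|z| = R\<close> for large \<open>R\<close>, and \<open>f\<^sup>-\<^sup>1(C) \<subseteq> C\<close> would put a point of \<open>C\<close> close to \<open>J\<close>. Hence pullbacks
    of bounded components stay bounded.

  \<^item> Two components of the complement of a Fatou component that both omit \<open>\<infinity>\<close> would contain two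
    incomparable bounded components of the Julia set.
\<close>

section \<open>Level sets of polynomials\<close>

lemma poly_open_map:
  fixes p :: "complex poly"
  assumes "degree p > 0" "open U"
  shows "open (poly p ` U)"
proof (rule open_mapping_thm[where S = UNIV])
  show "\<not> poly p constant_on UNIV"
  proof
    assume "poly p constant_on UNIV"
    then obtain c where "\<And>z. poly p z = poly [:c:] z"
      by (auto simp: constant_on_def)
    then have "p = [:c:]" by (metis poly_eqI2 poly_ext)
    with assms show False by simp
  qed
qed (use assms in \<open>auto intro!: holomorphic_intros\<close>)

lemma poly_large:
  fixes p :: "complex poly"
  assumes "degree p > 0"
  shows "\<exists>r. \<forall>z. r \<le> cmod z \<longrightarrow> d \<le> cmod (poly p z)"
proof -
  obtain a q where p: "p = pCons a q" by (cases p)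
  with assms have "q \<noteq> 0" by auto
  from poly_infinity[OF this] show ?thesis by (simp add: p)
qed

lemma bounded_vimage_poly:
  fixes p :: "complex poly"
  assumes "degree p > 0" "bounded S"
  shows "bounded (poly p -` S)"
proof -
  obtain B where B: "\<And>w. w \<in> S \<Longrightarrow> cmod w \<le> B"
    using assms(2) by (auto simp: bounded_iff)
  obtain r where "\<forall>z. r \<le> cmod z \<longrightarrow> B + 1 \<le> cmod (poly p z)"
    using poly_large[OF assms(1)] by blast
  then have "cmod z \<le> r" if "z \<in> poly p -` S" for z
    using B[of "poly p z"] that by (smt (verit) vimageE)
  then show ?thesis by (auto simp: bounded_iff)
qed

lemma surj_poly:
  fixes p :: "complex poly"
  assumes "degree p > 0"
  shows "\<exists>z. poly p z = w"
proof -
  have "degree (p + [:- w:]) > 0" using assms by (subst degree_add_eq_left) auto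
  then have "\<not> constant (poly (p + [:- w:]))" by (simp add: constant_degree)
  then obtain z where "poly (p + [:- w:]) z = 0"
    using fundamental_theorem_of_algebra by blast
  then show ?thesis by (auto simp: add_eq_0_iff)
qed

lemma compact_vimage_poly:
  fixes p :: "complex poly"
  assumes "degree p > 0" "compact S"
  shows "compact (poly p -` S)"
  using assms bounded_vimage_poly[of p S] compact_imp_closed[of S]
  by (auto simp: compact_eq_bounded_closed intro!: continuous_closed_vimage)

section \<open>Connectedness of sublevel, superlevel and level sets\<close>

text \<open>If \<open>A\<close> and \<open>L - A\<close> were both non-empty, both would meet
  \<open>C\<close> and so separate it. The connected core \<open>C\<close> will be a large exterior
  domain, a set holding all roots, or the point at infinity.\<close>

lemma connected_if_pieces_meet:
  assumes "connected C" "C \<subseteq> L"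
    and meet: "\<And>A. \<lbrakk>openin (top_of_set L) A; closedin (top_of_set L) A; A \<noteq> {}\<rbrakk> \<Longrightarrow> A \<inter> C \<noteq> {}"
  shows "connected L"
  unfolding connected_clopen
proof (intro allI impI)
  fix A assume A: "openin (top_of_set L) A \<and> closedin (top_of_set L) A"
  show "A = {} \<or> A = L"
  proof (rule ccontr)
    assume "\<not> (A = {} \<or> A = L)"
    then have ne: "A \<noteq> {}" "L - A \<noteq> {}" "A \<subseteq> L"
      using A openin_imp_subset by blast+
    have "A \<inter> C \<noteq> {}" using meet A ne by blast
    moreover have "(L - A) \<inter> C \<noteq> {}"
      using A ne by (intro meet) (auto simp: openin_diff closedin_diff)
    moreover obtain T where "open T" "A = L \<inter> T" using A by (auto simp: openin_open)
    then have "openin (top_of_set C) (C \<inter> A)" using \<open>C \<subseteq> L\<close> by (auto simp: openin_open)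
    moreover obtain T' where "closed T'" "A = L \<inter> T'" using A by (auto simp: closedin_closed)
    then have "closedin (top_of_set C) (C \<inter> A)" using \<open>C \<subseteq> L\<close> by (auto simp: closedin_closed)
    ultimately show False
      using \<open>connected C\<close> unfolding connected_clopen by blast
  qed
qed

text \<open>Minimum modulus principle: at a non-zero minimum of the modulus on \<open>A\<close>,
  openness of \<open>p\<close> yields a nearby smaller value, and lowering the modulus does not
  leave the sublevel set.\<close>

lemma sublevel_piece_has_root:
  fixes p :: "complex poly"
  assumes p: "degree p > 0" and A: "openin (top_of_set {z. cmod (poly p z) \<le> s}) A" "compact A" "A \<noteq> {}"
  shows "\<exists>z\<in>A. poly p z = 0"
proof (rule ccontr)
  assume nr: "\<not> (\<exists>z\<in>A. poly p z = 0)"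
  have "continuous_on A (\<lambda>z. cmod (poly p z))" by (intro continuous_intros)
  then obtain a where a: "a \<in> A" "\<And>z. z \<in> A \<Longrightarrow> cmod (poly p a) \<le> cmod (poly p z)"
    using continuous_attains_inf[OF A(2,3)] by blast
  obtain T where T: "open T" "A = {z. cmod (poly p z) \<le> s} \<inter> T"
    using A(1) by (auto simp: openin_open)
  define w where "w = poly p a"
  have w: "w \<noteq> 0" "cmod w \<le> s" using nr a T by (auto simp: w_def)
  have "open (poly p ` T)" "w \<in> poly p ` T" using poly_open_map[OF p T(1)] a T by (auto simp: w_def)
  then obtain e where e: "e > 0" "ball w e \<subseteq> poly p ` T" by (meson openE)
  \<comment> \<open>The value is contracted radially towards 0: \<open>t * cmod w < e\<close> keeps
    it among the values taken on \<open>T\<close>, and \<open>t \<le> 1/2\<close> keeps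
    \<open>1 - t\<close> positive.\<close>
  define t where "t = min (1/2) (e / (2 * cmod w))"
  have t: "0 < t" "t \<le> 1/2" "t * cmod w < e"
  proof -
    show "0 < t" "t \<le> 1/2" using e w by (auto simp: t_def)
    have "t * cmod w \<le> e / (2 * cmod w) * cmod w" by (intro mult_right_mono) (auto simp: t_def)
    also have "\<dots> < e" using w e by (simp add: field_simps)
    finally show "t * cmod w < e" .
  qed
  define w' where "w' = (1 - of_real t) * w"
  have "dist w w' = t * cmod w"
    using t by (simp add: w'_def dist_norm algebra_simps norm_mult)
  then obtain z where z: "z \<in> T" "poly p z = w'" using e t by (metis imageE mem_ball subsetD)
  have "cmod w' = (1 - t) * cmod w"
    using t norm_of_real[of "1 - t", where ?'a = complex] by (simp add: w'_def norm_mult)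
  then have "cmod w' < cmod w" using t w by simp
  moreover from this have "z \<in> A" using T z w by auto
  ultimately show False using a(2)[of z] z w_def by auto
qed

text \<open>Maximum modulus principle: a maximal value on \<open>A\<close> can be pushed outwards,
  which does not leave the superlevel set.\<close>

lemma superlevel_piece_unbounded:
  fixes p :: "complex poly"
  assumes p: "degree p > 0" and A: "openin (top_of_set {z. s \<le> cmod (poly p z)}) A" "compact A" "A \<noteq> {}"
  shows False
proof -
  have "continuous_on A (\<lambda>z. cmod (poly p z))" by (intro continuous_intros)
  then obtain a where a: "a \<in> A" "\<And>z. z \<in> A \<Longrightarrow> cmod (poly p z) \<le> cmod (poly p a)"
    using continuous_attains_sup[OF A(2,3)] by blast
  obtain T where T: "open T" "A = {z. s \<le> cmod (poly p z)} \<inter> T"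
    using A(1) by (auto simp: openin_open)
  define w where "w = poly p a"
  have "open (poly p ` T)" "w \<in> poly p ` T" using poly_open_map[OF p T(1)] a T by (auto simp: w_def)
  then obtain e where e: "e > 0" "ball w e \<subseteq> poly p ` T" by (meson openE)
  obtain w' where w': "w' \<in> ball w e" "cmod w < cmod w'"
  proof (cases "w = 0")
    case True
    then show ?thesis using e by (intro that[of "of_real (e/2)"]) auto
  next
    case False
    show ?thesis
    proof (rule that[of "(1 + of_real (e / (2 * cmod w))) * w"])
      have pos: "e / (2 * cmod w) > 0" using False e by simp
      have "cmod ((1 + of_real (e / (2 * cmod w))) * w) = (1 + e / (2 * cmod w)) * cmod w"
        using pos norm_of_real[of "1 + e / (2 * cmod w)", where ?'a = complex] by (simp add: norm_mult)
      also have "\<dots> > cmod w" using e False by (simp add: algebra_simps)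
      finally show "cmod w < cmod ((1 + of_real (e / (2 * cmod w))) * w)" .
      have "dist w ((1 + of_real (e / (2 * cmod w))) * w) = cmod (of_real (e / (2 * cmod w)) * w)"
        by (simp add: dist_norm algebra_simps)
      also have "\<dots> = e / 2" using pos False e by (simp add: norm_mult norm_divide)
      finally show "(1 + of_real (e / (2 * cmod w))) * w \<in> ball w e" using e by simp
    qed
  qed
  then obtain z where z: "z \<in> T" "poly p z = w'" using e by blast
  moreover have "z \<in> A" using T z w' a w_def by auto
  ultimately show False using a(2)[of z] w' w_def by auto
qed

text \<open>The exterior of a large disc is a connected core, and a clopen piece that missed it
  would be compact.\<close>

lemma connected_superlevel:
  fixes p :: "complex poly"
  assumes p: "degree p > 0"
  shows "connected {z. s \<le> cmod (poly p z)}"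
proof -
  obtain r where r: "\<forall>z. r \<le> cmod z \<longrightarrow> s \<le> cmod (poly p z)"
    using poly_large[OF p] by blast
  show ?thesis
  proof (rule connected_if_pieces_meet[where C = "- cball 0 r"])
    show "connected (- cball (0::complex) r)"
      by (intro connected_complement_bounded_convex) auto
    show "- cball 0 r \<subseteq> {z. s \<le> cmod (poly p z)}" using r by auto
    fix A assume A: "openin (top_of_set {z. s \<le> cmod (poly p z)}) A"
      "closedin (top_of_set {z. s \<le> cmod (poly p z)}) A" "A \<noteq> {}"
    have "closed {z. s \<le> cmod (poly p z)}"
      by (intro closed_Collect_le continuous_intros)
    then have "closed A" using A closedin_closed_trans by blast
    show "A \<inter> - cball 0 r \<noteq> {}"
    proof
      assume "A \<inter> - cball 0 r = {}"
      then have "compact A"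
        using \<open>closed A\<close> bounded_subset[OF bounded_cball, of A 0 r] by (auto simp: compact_eq_bounded_closed)
      then show False using superlevel_piece_unbounded[OF p A(1)] A by blast
    qed
  qed
qed

lemma compact_sublevel:
  fixes p :: "complex poly"
  assumes "degree p > 0"
  shows "compact {z. cmod (poly p z) \<le> s}"
proof -
  have "{z. cmod (poly p z) \<le> s} = poly p -` cball 0 s" by auto
  then show ?thesis using compact_vimage_poly[OF assms compact_cball, of 0 s] by simp
qed

text \<open>Every clopen piece is compact, hence contains a root, hence meets
  \<open>C\<close>.\<close>

lemma connected_sublevel_if_roots:
  fixes p :: "complex poly"
  assumes p: "degree p > 0" and C: "connected C" "C \<subseteq> {z. cmod (poly p z) \<le> s}"
    and roots: "\<And>z. poly p z = 0 \<Longrightarrow> z \<in> C"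
  shows "connected {z. cmod (poly p z) \<le> s}"
proof (rule connected_if_pieces_meet[OF C])
  fix A assume A: "openin (top_of_set {z. cmod (poly p z) \<le> s}) A"
      "closedin (top_of_set {z. cmod (poly p z) \<le> s}) A" "A \<noteq> {}"
  have "compact A" using A(2) compact_sublevel[OF p, of s] closedin_compact_eq by blast
  then show "A \<inter> C \<noteq> {}" using sublevel_piece_has_root[OF p A(1)] A roots by blast
qed

text \<open>If the open sublevel set split, the closures of the two parts would cover the connected
  closed sublevel set and meet at a point of level \<open>s\<close>. That point is not critical, so
  the open sublevel set is connected near it, although both parts accumulate there.\<close>

lemma connected_strict_sublevel:
  fixes p :: "complex poly"
  assumes p: "degree p > 0" and "s > 0"
    and con: "connected {z. cmod (poly p z) \<le> s}"
    and crit: "\<And>z. poly (pderiv p) z = 0 \<Longrightarrow> cmod (poly p z) < s"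
  shows "connected {z. cmod (poly p z) < s}" (is "connected ?O")
proof (rule ccontr)
  have opO: "open ?O" by (intro open_Collect_less continuous_intros)
  assume "\<not> connected ?O"
  then obtain A B where AB: "open A" "open B" "?O \<subseteq> A \<union> B" "A \<inter> B \<inter> ?O = {}" "A \<inter> ?O \<noteq> {}" "B \<inter> ?O \<noteq> {}"
    unfolding connected_def by blast
  have cl: "{z. cmod (poly p z) \<le> s} \<subseteq> closure ?O"
  proof
    fix z assume z: "z \<in> {z. cmod (poly p z) \<le> s}"
    show "z \<in> closure ?O"
      unfolding closure_iff_nhds_not_empty
    proof (intro allI impI)
      fix X V assume V: "V \<subseteq> X" "open V" "z \<in> V"
      have "open (poly p ` V)" "poly p z \<in> poly p ` V" using poly_open_map[OF p V(2)] V by auto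
      moreover have "poly p z \<in> closure (ball 0 s)" using z \<open>s > 0\<close> by simp
      ultimately obtain w where "w \<in> poly p ` V" "w \<in> ball 0 s"
        by (meson closure_iff_nhds_not_empty disjoint_iff order_refl)
      then show "?O \<inter> X \<noteq> {}" using V by auto
    qed
  qed
  have "closure (A \<inter> ?O) \<inter> closure (B \<inter> ?O) \<inter> {z. cmod (poly p z) \<le> s} \<noteq> {}"
  proof -
    have "{z. cmod (poly p z) \<le> s} \<subseteq> closure (A \<inter> ?O) \<union> closure (B \<inter> ?O)"
      using cl AB(3) by (metis (no_types, lifting) Int_Un_distrib2 closure_Un inf.absorb_iff2)
    moreover have "closure (A \<inter> ?O) \<inter> {z. cmod (poly p z) \<le> s} \<noteq> {}"
      using AB(5) closure_subset[of "A \<inter> ?O"] by (auto simp: less_imp_le)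
    moreover have "closure (B \<inter> ?O) \<inter> {z. cmod (poly p z) \<le> s} \<noteq> {}"
      using AB(6) closure_subset[of "B \<inter> ?O"] by (auto simp: less_imp_le)
    ultimately show ?thesis
      using con unfolding connected_closed by (metis closed_closure)
  qed
  then obtain z where z: "z \<in> closure (A \<inter> ?O)" "z \<in> closure (B \<inter> ?O)" "cmod (poly p z) \<le> s" by auto
  have meets: "V \<inter> (A \<inter> ?O) \<noteq> {}" "V \<inter> (B \<inter> ?O) \<noteq> {}" if "open V" "z \<in> V" for V
    using z that by (meson disjoint_iff closure_iff_nhds_not_empty order_refl)+
  have "z \<notin> ?O"
  proof
    assume "z \<in> ?O"
    then consider "z \<in> A \<inter> ?O" | "z \<in> B \<inter> ?O" using AB by blast
    then show False
      by cases (use meets[of "A \<inter> ?O"] meets[of "B \<inter> ?O"] AB opO in \<open>auto simp: open_Int\<close>)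
  qed
  then have "poly (pderiv p) z \<noteq> 0" using crit z by fastforce
  then have "deriv (poly p) z \<noteq> 0" by (simp add: DERIV_imp_deriv[OF poly_DERIV])
  moreover have hol: "poly p holomorphic_on S" for S
    using holomorphic_on_subset[of "poly p" UNIV S] by (auto intro!: holomorphic_intros)
  ultimately obtain r where r: "r > 0" "open (poly p ` ball z r)" "inj_on (poly p) (ball z r)"
    using has_complex_derivative_locally_invertible[of "poly p" UNIV z] hol by auto
  obtain g where g: "g holomorphic_on poly p ` ball z r" "\<And>y. y \<in> ball z r \<Longrightarrow> g (poly p y) = y"
    using holomorphic_has_inverse[OF hol open_ball r(3)] by metis
  obtain e where e: "e > 0" "ball (poly p z) e \<subseteq> poly p ` ball z r"
    using r by (meson centre_in_ball image_eqI openE)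
  \<comment> \<open>An intersection of two discs is convex, so its image under the local inverse
    \<open>g\<close> is connected; this image contains all points of the open sublevel set close to
    \<open>z\<close>.\<close>
  define D where "D = ball (poly p z) e \<inter> ball 0 s"
  have "connected (g ` D)"
  proof (rule connected_continuous_image)
    show "continuous_on D g"
      using holomorphic_on_imp_continuous_on[OF g(1)] e by (auto simp: D_def intro: continuous_on_subset)
    show "connected D" unfolding D_def by (intro convex_connected convex_Int convex_ball)
  qed
  have gD: "g ` D \<subseteq> ?O"
  proof
    fix y assume "y \<in> g ` D"
    then obtain w where w: "w \<in> D" "y = g w" by auto
    then obtain y' where "y' \<in> ball z r" "w = poly p y'" using e by (auto simp: D_def)
    then show "y \<in> ?O" using g(2)[of y'] w by (auto simp: D_def)
  qed
  define V where "V = ball z r \<inter> poly p -` ball (poly p z) e"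
  have V: "open V" "z \<in> V"
    using r e by (auto simp: V_def intro!: open_Int continuous_open_vimage continuous_intros)
  have VD: "V \<inter> ?O \<subseteq> g ` D"
  proof
    fix y assume "y \<in> V \<inter> ?O"
    then have "poly p y \<in> D" "g (poly p y) = y" using g(2) by (auto simp: V_def D_def)
    then show "y \<in> g ` D" by (metis image_eqI)
  qed
  have "A \<inter> g ` D \<noteq> {}" "B \<inter> g ` D \<noteq> {}" using meets[OF V] VD by blast+
  moreover have "g ` D \<subseteq> A \<union> B" "A \<inter> B \<inter> g ` D = {}" using gD AB by blast+
  ultimately show False using \<open>connected (g ` D)\<close> AB(1,2) unfolding connected_def by blast
qed

text \<open>Paths in the open sublevel set join the finitely many roots. Their union is compact and
  connected, so the modulus has a maximum below \<open>s\<close> on it, and every sublevel set from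
  that maximum on contains this connected set of all roots.\<close>

lemma connected_sublevel_step:
  fixes p :: "complex poly"
  assumes p: "degree p > 0" and "s > 0"
    and con: "connected {z. cmod (poly p z) \<le> s}"
    and crit: "\<And>z. poly (pderiv p) z = 0 \<Longrightarrow> cmod (poly p z) < s"
  shows "\<exists>s'<s. \<forall>t\<ge>s'. t \<le> s \<longrightarrow> connected {z. cmod (poly p z) \<le> t}"
proof -
  let ?O = "{z. cmod (poly p z) < s}"
  have opO: "open ?O" by (intro open_Collect_less continuous_intros)
  have pc: "path_connected ?O"
    using connected_strict_sublevel[OF assms] opO connected_open_path_connected by blast
  obtain z0 where z0: "poly p z0 = 0" using surj_poly[OF p] by blast
  define Z where "Z = {z. poly p z = 0}"
  have finZ: "finite Z" unfolding Z_def using p by (intro poly_roots_finite) auto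
  have "\<exists>g. path g \<and> path_image g \<subseteq> ?O \<and> pathstart g = z0 \<and> pathfinish g = z" if "z \<in> Z" for z
    using pc that z0 \<open>s > 0\<close> unfolding path_connected_def by (auto simp: Z_def)
  then obtain g where g: "\<And>z. z \<in> Z \<Longrightarrow> path (g z) \<and> path_image (g z) \<subseteq> ?O \<and> pathstart (g z) = z0 \<and> pathfinish (g z) = z"
    by metis
  define C where "C = (\<Union>z\<in>Z. path_image (g z))"
  have cC: "compact C" unfolding C_def using finZ g by (intro compact_UN) auto
  have "connected C" unfolding C_def
  proof (rule connected_Union)
    have "z0 \<in> \<Inter> ((\<lambda>z. path_image (g z)) ` Z)" using g pathstart_in_path_image by fastforce
    then show "\<Inter> ((\<lambda>z. path_image (g z)) ` Z) \<noteq> {}" by blast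
  qed (use g in \<open>auto simp: connected_path_image\<close>)
  have ZC: "z \<in> C" if "poly p z = 0" for z
    using that g[of z] pathfinish_in_path_image[of "g z"] unfolding C_def by (auto simp: Z_def)
  have CO: "C \<subseteq> ?O" using g by (auto simp: C_def)
  have "continuous_on C (\<lambda>z. cmod (poly p z))" by (intro continuous_intros)
  moreover have "C \<noteq> {}" using ZC z0 by blast
  ultimately obtain a where a: "a \<in> C" "\<And>z. z \<in> C \<Longrightarrow> cmod (poly p z) \<le> cmod (poly p a)"
    using continuous_attains_sup[OF cC] by blast
  have "connected {z. cmod (poly p z) \<le> t}" if "t \<ge> cmod (poly p a)" for t
    by (rule connected_sublevel_if_roots[OF p \<open>connected C\<close>]) (use a that ZC in fastforce)+
  moreover have "cmod (poly p a) < s" using a CO by auto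
  ultimately show ?thesis by blast
qed

text \<open>Lowering the level from a large value, connectedness can only be lost at a critical level.\<close>

lemma connected_sublevel:
  fixes p :: "complex poly"
  assumes p: "degree p > 0" and "R > 0"
    and crit: "\<And>z. poly (pderiv p) z = 0 \<Longrightarrow> cmod (poly p z) < R"
    and "S \<ge> R"
  shows "connected {z. cmod (poly p z) \<le> S}"
proof -
  let ?L = "\<lambda>s. {z. cmod (poly p z) \<le> s}"
  \<comment> \<open>\<open>T\<close> is non-empty because a disc containing all roots lies in every
    sufficiently high sublevel set. The aim is to show that its infimum is \<open>S\<close>.\<close>
  define T where "T = {s. s \<ge> S \<and> (\<forall>t\<ge>s. connected (?L t))}"
  have "T \<noteq> {}"
  proof -
    obtain r where r: "\<forall>z. r \<le> cmod z \<longrightarrow> 1 \<le> cmod (poly p z)" using poly_large[OF p] by blast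
    have "compact (poly p ` cball 0 r)" by (intro compact_continuous_image continuous_intros compact_cball)
    then obtain M where M: "\<And>z. z \<in> cball 0 r \<Longrightarrow> cmod (poly p z) \<le> M"
      using compact_imp_bounded[of "poly p ` cball 0 r"] unfolding bounded_iff by blast
    have "connected (?L t)" if "t \<ge> M" for t
    proof (rule connected_sublevel_if_roots[OF p connected_cball[of 0 r]])
      show "cball 0 r \<subseteq> ?L t" using M that by fastforce
      show "z \<in> cball 0 r" if "poly p z = 0" for z
        using r[rule_format, of z] that by (cases "cmod z \<le> r") auto
    qed
    then have "max M S \<in> T" by (auto simp: T_def)
    then show ?thesis by blast
  qed
  define s where "s = Inf T"
  have bdd: "bdd_below T" by (auto simp: T_def bdd_below_def)
  have "s \<ge> S" unfolding s_def using \<open>T \<noteq> {}\<close> by (intro cInf_greatest) (auto simp: T_def)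
  have above: "connected (?L t)" if "t > s" for t
  proof -
    obtain u where "u \<in> T" "u < t" using \<open>t > s\<close> cInf_lessD[OF \<open>T \<noteq> {}\<close>, of t] s_def by blast
    then show ?thesis by (auto simp: T_def)
  qed
  \<comment> \<open>The infimum itself is a good level: its sublevel set is a decreasing
    intersection of compact connected sets.\<close>
  have "connected (\<Inter> (range (\<lambda>n::nat. ?L (s + 1 / Suc n))))"
  proof (rule connected_nest)
    show "?L (s + 1 / Suc n) \<subseteq> ?L (s + 1 / Suc m)" if "m \<le> n" for m n :: nat
      using that by (auto elim!: order_trans intro!: divide_left_mono)
  qed (auto intro!: compact_sublevel p above)
  moreover have "\<Inter> (range (\<lambda>n::nat. ?L (s + 1 / Suc n))) = ?L s"
  proof (intro equalityI subsetI)
    fix z assume z: "z \<in> \<Inter> (range (\<lambda>n::nat. ?L (s + 1 / Suc n)))"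
    have "cmod (poly p z) \<le> s + e" if "e > 0" for e
    proof -
      obtain n :: nat where "inverse (Suc n) < e" using reals_Archimedean[OF \<open>e > 0\<close>] by blast
      moreover have "cmod (poly p z) \<le> s + 1 / Suc n" using z by blast
      ultimately show ?thesis by (simp add: inverse_eq_divide)
    qed
    then show "z \<in> ?L s" by (simp add: field_le_epsilon)
  qed (auto elim!: order_trans)
  ultimately have cons: "connected (?L s)" by simp
  show ?thesis
  proof (cases "s = S")
    case False
    then have "s > S" using \<open>s \<ge> S\<close> by simp
    \<comment> \<open>Level \<open>s\<close> lies above all critical levels, so connectedness
      persists slightly below it, contradicting the choice of \<open>s\<close> as infimum.\<close>
    obtain s' where s': "s' < s" "\<And>t. s' \<le> t \<Longrightarrow> t \<le> s \<Longrightarrow> connected (?L t)"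
      using connected_sublevel_step[OF p _ cons] crit \<open>R > 0\<close> \<open>S \<ge> R\<close> \<open>s > S\<close> by (smt (verit))
    have "max s' S \<in> T"
      using s' above by (force simp: T_def not_less)
    then have "s \<le> max s' S" unfolding s_def by (rule cInf_lower[OF _ bdd])
    then show ?thesis using s' \<open>s > S\<close> by auto
  qed (use cons in simp)
qed

text \<open>Unicoherence of the plane: two closed connected sets that cover it have a connected
  intersection.\<close>

lemma connected_level:
  fixes p :: "complex poly"
  assumes p: "degree p > 0" and "R > 0"
    and crit: "\<And>z. poly (pderiv p) z = 0 \<Longrightarrow> cmod (poly p z) < R"
    and "S \<ge> R"
  shows "connected {z. cmod (poly p z) = S}"
proof -
  have "connected ({z. cmod (poly p z) \<le> S} \<inter> {z. S \<le> cmod (poly p z)})"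
  proof (rule unicoherentD[OF unicoherent_UNIV])
    show "connected {z. cmod (poly p z) \<le> S}" by (rule connected_sublevel[OF assms])
    show "connected {z. S \<le> cmod (poly p z)}" by (rule connected_superlevel[OF p])
  qed (auto intro!: closed_Collect_le continuous_intros)
  moreover have "{z. cmod (poly p z) \<le> S} \<inter> {z. S \<le> cmod (poly p z)} = {z. cmod (poly p z) = S}" by auto
  ultimately show ?thesis by simp
qed

section \<open>Topology of the Riemann sphere\<close>

lemma dist_Fin_Fin_squared:
  "(dist (Fin z) (Fin w))\<^sup>2 = 4 * (cmod (z - w))\<^sup>2 / ((1 + (cmod z)\<^sup>2) * (1 + (cmod w)\<^sup>2))"
proof -
  define A B where "A = 1 + (cmod z)\<^sup>2" and "B = 1 + (cmod w)\<^sup>2"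
  have pos: "A > 0" "B > 0" by (auto simp: A_def B_def add_pos_nonneg)
  \<comment> \<open>Writing the height as \<open>1 - 2 / A\<close> makes the claim a rational
    identity in \<open>A\<close>, \<open>B\<close> and the inner product of \<open>z\<close> and
    \<open>w\<close>.\<close>
  have st: "stereo (Fin z) = ((2 / A) *\<^sub>R z, 1 - 2 / A)" "stereo (Fin w) = ((2 / B) *\<^sub>R w, 1 - 2 / B)"
    using pos by (auto simp: A_def B_def field_simps)
  have *: "(cmod (z - w))\<^sup>2 = A - 1 + (B - 1) - 2 * (z \<bullet> w)"
    by (simp add: A_def B_def power2_norm_eq_inner inner_diff_left inner_diff_right inner_commute)
  have "(norm (a *\<^sub>R z - b *\<^sub>R w))\<^sup>2 = a\<^sup>2 * (A - 1) + b\<^sup>2 * (B - 1) - 2 * a * b * (z \<bullet> w)" for a b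
    unfolding A_def B_def power2_norm_eq_inner
    by (simp add: inner_diff_left inner_diff_right inner_commute power2_eq_square algebra_simps)
  moreover have "(dist (Fin z) (Fin w))\<^sup>2 = (norm ((2 / A) *\<^sub>R z - (2 / B) *\<^sub>R w))\<^sup>2 + (1 - 2 / A - (1 - 2 / B))\<^sup>2"
    unfolding dist_riemann_sphere_def st dist_Pair_Pair by (simp add: dist_norm)
  ultimately have "(dist (Fin z) (Fin w))\<^sup>2 = (2 / A)\<^sup>2 * (A - 1) + (2 / B)\<^sup>2 * (B - 1)
      - 2 * (2 / A) * (2 / B) * (z \<bullet> w) + (2 / B - 2 / A)\<^sup>2"
    by simp
  also have "\<dots> = 4 * (A - 1 + (B - 1) - 2 * (z \<bullet> w)) / (A * B)"
    using pos by (simp add: field_simps power2_eq_square)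
  finally show ?thesis by (simp only: * flip: A_def B_def)
qed

lemma dist_Fin_Fin_le: "dist (Fin z) (Fin w) \<le> 2 * dist z w"
proof (rule power2_le_imp_le)
  have "1 * 1 \<le> (1 + (cmod z)\<^sup>2) * (1 + (cmod w)\<^sup>2)"
    by (intro mult_mono) auto
  then have "4 * (cmod (z - w))\<^sup>2 / ((1 + (cmod z)\<^sup>2) * (1 + (cmod w)\<^sup>2)) \<le> 4 * (cmod (z - w))\<^sup>2 / 1"
    by (intro divide_left_mono) auto
  then show "(dist (Fin z) (Fin w))\<^sup>2 \<le> (2 * dist z w)\<^sup>2"
    by (simp add: dist_Fin_Fin_squared dist_norm power_mult_distrib)
qed simp

lemma dist_Fin_Infty: "dist (Fin z) Infty = 2 / sqrt (1 + (cmod z)\<^sup>2)"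
proof -
  define A where "A = 1 + (cmod z)\<^sup>2"
  have pos: "A > 0" by (auto simp: A_def add_pos_nonneg)
  have st: "stereo (Fin z) = ((2 / A) *\<^sub>R z, 1 - 2 / A)"
    using pos by (auto simp: A_def field_simps)
  have "(dist (Fin z) Infty)\<^sup>2 = (norm ((2 / A) *\<^sub>R z))\<^sup>2 + (2 / A)\<^sup>2"
    unfolding dist_riemann_sphere_def st by (simp add: dist_norm norm_Pair power_divide)
  also have "(norm ((2 / A) *\<^sub>R z))\<^sup>2 = (2 / A)\<^sup>2 * (A - 1)"
    by (simp add: A_def power_mult_distrib power_divide)
  also have "(2 / A)\<^sup>2 * (A - 1) + (2 / A)\<^sup>2 = (2 / sqrt A)\<^sup>2"
    using pos by (simp add: power_divide field_simps power2_eq_square)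
  finally show ?thesis using pos by (simp add: A_def power2_eq_iff_nonneg)
qed

lemma dist_Fin_Infty_less:
  assumes "e > 0" "2 / e < cmod z"
  shows "dist (Fin z) Infty < e"
proof -
  have "cmod z \<le> sqrt (1 + (cmod z)\<^sup>2)" by (rule real_le_rsqrt) simp
  then have "2 / e < sqrt (1 + (cmod z)\<^sup>2)" using assms by linarith
  moreover have "sqrt (1 + (cmod z)\<^sup>2) > 0" by (simp add: add_pos_nonneg)
  ultimately show ?thesis using \<open>e > 0\<close> unfolding dist_Fin_Infty by (simp add: field_simps)
qed

lemma dist_Fin_Infty_ge:
  assumes "cmod z \<le> R"
  shows "2 / sqrt (1 + R\<^sup>2) \<le> dist (Fin z) Infty"
proof -
  have "(cmod z)\<^sup>2 \<le> R\<^sup>2" using assms by (simp add: power_mono)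
  moreover have "1 + (cmod z)\<^sup>2 > 0" by (simp add: add_pos_nonneg)
  ultimately show ?thesis unfolding dist_Fin_Infty
    by (intro divide_left_mono) (auto intro!: mult_pos_pos add_pos_nonneg)
qed

lemma continuous_on_Fin: "continuous_on S Fin"
  unfolding continuous_on_iff
proof (intro ballI allI impI)
  fix x and e :: real assume "e > 0"
  then have "dist (Fin x') (Fin x) < e" if "dist x' x < e / 2" for x'
    using dist_Fin_Fin_le[of x' x] that by linarith
  with \<open>e > 0\<close> show "\<exists>d>0. \<forall>x'\<in>S. dist x' x < d \<longrightarrow> dist (Fin x') (Fin x) < e"
    by (metis half_gt_zero)
qed

text \<open>Stereographic projection from the north pole, the left inverse of \<open>Fin\<close>.
  Division by zero gives it the value 0 at \<open>Infty\<close>, so continuity is claimed only away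
  from that point.\<close>

definition plane_coord :: "riemann_sphere \<Rightarrow> complex" where
  "plane_coord y = fst (stereo y) /\<^sub>R (1 - snd (stereo y))"

lemma plane_coord_Fin [simp]: "plane_coord (Fin z) = z"
proof -
  define A where "A = 1 + (cmod z)\<^sup>2"
  have pos: "A > 0" by (auto simp: A_def add_pos_nonneg)
  have st: "stereo (Fin z) = ((2 / A) *\<^sub>R z, 1 - 2 / A)"
    using pos by (auto simp: A_def field_simps)
  show ?thesis using pos unfolding plane_coord_def st by simp
qed

lemma continuous_on_stereo: "continuous_on S stereo"
  unfolding continuous_on_iff dist_riemann_sphere_def by blast

lemma range_Fin: "range Fin = - {Infty}"
proof -
  have "x \<in> range Fin" if "x \<noteq> Infty" for x using that by (cases x) auto
  then show ?thesis by auto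
qed

lemma stereo_on_sphere: "stereo x \<in> sphere 0 1"
proof (cases x)
  case (Fin z)
  define A where "A = 1 + (cmod z)\<^sup>2"
  have pos: "A > 0" by (auto simp: A_def add_pos_nonneg)
  have st: "stereo (Fin z) = ((2 / A) *\<^sub>R z, 1 - 2 / A)"
    using pos by (auto simp: A_def field_simps)
  have nP: "(norm (u, t))\<^sup>2 = (norm u)\<^sup>2 + (norm t)\<^sup>2" for u :: complex and t :: real
    by (simp add: norm_Pair)
  have *: "(norm ((2 / A) *\<^sub>R z))\<^sup>2 = (2 / A)\<^sup>2 * (A - 1)"
    by (simp add: A_def power_mult_distrib power_divide)
  have "(norm (stereo (Fin z)))\<^sup>2 = (2 / A)\<^sup>2 * (A - 1) + (1 - 2 / A)\<^sup>2"
    unfolding st nP * by simp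
  also have "\<dots> = 1" using pos by (simp add: field_simps power2_eq_square)
  finally show ?thesis using Fin by (simp add: dist_norm power2_eq_1_iff del: stereo.simps)
       (smt (verit) norm_ge_zero)
qed (simp add: norm_Pair)

lemma range_stereo: "range stereo = sphere 0 1"
proof (intro equalityI subsetI)
  fix y :: "complex \<times> real" assume y: "y \<in> sphere 0 1"
  obtain u t where yt: "y = (u, t)" by (cases y)
  have n: "(cmod u)\<^sup>2 + t\<^sup>2 = 1" using y by (simp add: yt norm_Pair)
  show "y \<in> range stereo"
  proof (cases "t = 1")
    case True
    then have "y = stereo Infty" using n by (simp add: yt)
    then show ?thesis by blast
  next
    case False
    have "t\<^sup>2 \<le> 1" using n by (smt (verit) zero_le_power2)
    then have t: "t < 1" using False by (simp add: abs_square_le_1)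
    \<comment> \<open>The line from the north pole through \<open>y\<close> meets the plane in
      \<open>z\<close>.\<close>
    define z where "z = u /\<^sub>R (1 - t)"
    have "(cmod z)\<^sup>2 = (1 - t\<^sup>2) / (1 - t)\<^sup>2"
      using n by (simp add: z_def power_mult_distrib power_inverse divide_inverse flip: n)
    also have "\<dots> = (1 + t) / (1 - t)"
    proof -
      have "(1 - t\<^sup>2) / (1 - t)\<^sup>2 = ((1 + t) * (1 - t)) / ((1 - t) * (1 - t))"
        by (simp add: power2_eq_square algebra_simps)
      then show ?thesis using t by simp
    qed
    finally have z2: "(cmod z)\<^sup>2 = (1 + t) / (1 - t)" .
    have "2 / (1 + (cmod z)\<^sup>2) = 1 - t" using t unfolding z2 by (simp add: field_simps)
    then have "(2 / (1 + (cmod z)\<^sup>2)) *\<^sub>R z = (1 - t) *\<^sub>R z" by (simp only:)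
    also have "\<dots> = u" using t by (simp add: z_def)
    finally have "(2 / (1 + (cmod z)\<^sup>2)) *\<^sub>R z = u" .
    moreover have "((cmod z)\<^sup>2 - 1) / ((cmod z)\<^sup>2 + 1) = t" using t unfolding z2 by (simp add: field_simps)
    ultimately have "stereo (Fin z) = y" by (simp add: yt)
    then show ?thesis by blast
  qed
qed (use stereo_on_sphere in blast)

text \<open>By definition of the metric \<open>stereo\<close> is an isometry, so its inverse is
  continuous too. Compactness, connectedness and simple connectedness are then inherited from the
  unit sphere.\<close>

lemma homeomorphism_stereo: "homeomorphism UNIV (sphere 0 1) stereo (inv stereo)"
proof
  show "continuous_on (sphere 0 1) (inv stereo)"
    unfolding continuous_on_iff range_stereo[symmetric]
    by (auto simp: inv_f_f[OF inj_stereo] dist_riemann_sphere_def)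
qed (use stereo_on_sphere in \<open>auto simp: continuous_on_stereo inv_f_f[OF inj_stereo] f_inv_into_f range_stereo\<close>)

lemma compact_sphere_UNIV: "compact (UNIV :: riemann_sphere set)"
  using homeomorphic_compactness[of "UNIV :: riemann_sphere set" "sphere 0 1 :: (complex \<times> real) set"]
    homeomorphism_stereo by (auto simp: homeomorphic_def)

lemma compact_if_closed_sphere: "closed K \<Longrightarrow> compact (K :: riemann_sphere set)"
  using compact_Int_closed[OF compact_sphere_UNIV] by simp

lemma connected_sphere_UNIV: "connected (UNIV :: riemann_sphere set)"
proof -
  have "connected (sphere 0 1 :: (complex \<times> real) set)"
    by (rule connected_sphere) simp
  then show ?thesis
    using homeomorphic_connectedness homeomorphism_stereo unfolding homeomorphic_def by blast
qed

lemma simply_connected_sphere_UNIV: "simply_connected (UNIV :: riemann_sphere set)"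
proof -
  have "simply_connected (sphere 0 1 :: (complex \<times> real) set)"
    by (rule simply_connected_sphere) simp
  then show ?thesis
    using homeomorphic_simply_connected_eq homeomorphism_stereo unfolding homeomorphic_def by blast
qed

lemma continuous_on_plane_coord: "continuous_on (- {Infty}) plane_coord"
proof -
  have "snd (stereo y) \<noteq> 1" if "y \<noteq> Infty" for y
  proof
    assume "snd (stereo y) = 1"
    moreover from this have "fst (stereo y) = 0"
      using stereo_on_sphere[of y] by (cases "stereo y") (simp add: norm_Pair)
    ultimately have "stereo y = stereo Infty" by (simp add: prod_eq_iff)
    then show False using that inj_stereo by (meson injD)
  qed
  then show ?thesis unfolding plane_coord_def
    by (intro continuous_intros continuous_on_stereo) auto
qed

lemma open_Fin_image: "open S \<Longrightarrow> open (Fin ` S)"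
proof -
  assume "open S"
  have "Fin ` S = plane_coord -` S \<inter> - {Infty}"
  proof -
    have "y \<in> Fin ` S" if "plane_coord y \<in> S" "y \<noteq> Infty" for y using that by (cases y) auto
    then show ?thesis by auto
  qed
  moreover have "open (plane_coord -` S \<inter> - {Infty})"
    using continuous_on_plane_coord \<open>open S\<close> by (simp add: continuous_on_open_vimage open_Compl)
  ultimately show ?thesis by simp
qed

lemma open_vimage_Fin: "open S \<Longrightarrow> open (Fin -` S)"
  using continuous_on_Fin[of UNIV] by (simp add: continuous_on_open_vimage)

lemma closed_vimage_Fin: "closed S \<Longrightarrow> closed (Fin -` S)"
  using open_vimage_Fin[of "- S"] by (simp add: closed_def vimage_Compl)

lemma vimage_Fin_image [simp]: "Fin -` Fin ` S = S"
  by auto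

lemma image_vimage_Fin: "K \<subseteq> range Fin \<Longrightarrow> Fin ` (Fin -` K) = K"
  by auto

text \<open>A preimage becomes a continuous image, so connectedness and compactness pass from the
  sphere to the plane.\<close>

lemma vimage_Fin_eq_coord:
  assumes "K \<subseteq> range Fin"
  shows "Fin -` K = plane_coord ` K"
proof
  show "plane_coord ` K \<subseteq> Fin -` K" using assms by fastforce
  show "Fin -` K \<subseteq> plane_coord ` K"
  proof
    fix z assume "z \<in> Fin -` K"
    then show "z \<in> plane_coord ` K" using imageI[of "Fin z" K plane_coord] by simp
  qed
qed

lemma connected_vimage_Fin:
  assumes "K \<subseteq> range Fin" "connected K"
  shows "connected (Fin -` K)"
  unfolding vimage_Fin_eq_coord[OF assms(1)]
  using assms continuous_on_subset[OF continuous_on_plane_coord]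
  by (intro connected_continuous_image) (auto simp: range_Fin)

lemma connected_Fin_image: "connected S \<Longrightarrow> connected (Fin ` S)"
  by (intro connected_continuous_image continuous_on_Fin)

lemma compact_Fin_image: "compact S \<Longrightarrow> compact (Fin ` S)"
  by (intro compact_continuous_image continuous_on_Fin)

lemma compact_vimage_Fin:
  assumes "K \<subseteq> range Fin" "closed K"
  shows "compact (Fin -` K)"
  unfolding vimage_Fin_eq_coord[OF assms(1)]
  using assms continuous_on_subset[OF continuous_on_plane_coord]
  by (intro compact_continuous_image compact_if_closed_sphere) (auto simp: range_Fin)

lemma open_Infty_nhd: "open (insert Infty (Fin ` {z. R < cmod z}))"
proof -
  have "x \<in> Fin ` cball 0 R" if "x \<notin> insert Infty (Fin ` {z. R < cmod z})" for x
    using that by (cases x) (force simp: not_less)+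
  then have "insert Infty (Fin ` {z. R < cmod z}) = - Fin ` cball 0 R" by force
  moreover have "closed (Fin ` cball 0 R)" by (intro compact_imp_closed compact_Fin_image compact_cball)
  ultimately show ?thesis by (simp add: open_Compl)
qed

lemma open_Infty_contains:
  assumes "open U" "Infty \<in> U"
  obtains R where "insert Infty (Fin ` {z. R < cmod z}) \<subseteq> U"
proof -
  obtain e where e: "e > 0" "\<And>y. dist y Infty < e \<Longrightarrow> y \<in> U"
    using assms by (metis open_dist)
  have "insert Infty (Fin ` {z. 2 / e < cmod z}) \<subseteq> U"
    using e dist_Fin_Infty_less assms by auto
  then show thesis by (rule that)
qed

section \<open>Polynomials as continuous, open and closed maps of the sphere\<close>

lemma Fin_poly_vimage [simp]: "Fin -` (sphere_map p -` K) = poly p -` (Fin -` K)"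
  by auto

lemma sphere_map_vimage_subset_range:
  "\<lbrakk>degree p > 0; K \<subseteq> range Fin\<rbrakk> \<Longrightarrow> sphere_map p -` K \<subseteq> range Fin"
  by (auto simp: range_Fin)

lemma sphere_map_vimage_Fin_image:
  assumes "degree p > 0"
  shows "sphere_map p -` (Fin ` S) = Fin ` (poly p -` S)"
proof (intro set_eqI)
  fix x show "x \<in> sphere_map p -` (Fin ` S) \<longleftrightarrow> x \<in> Fin ` (poly p -` S)"
    using assms by (cases x) auto
qed

lemma surj_sphere_map:
  assumes "degree p > 0"
  shows "\<exists>x. sphere_map p x = y"
proof (cases y)
  case (Fin w)
  obtain z where "poly p z = w" using surj_poly[OF assms] by blast
  then show ?thesis using Fin by (intro exI[of _ "Fin z"]) simp
qed (use assms in \<open>intro exI[of _ Infty], simp\<close>)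

lemma open_sphere_map_vimage:
  assumes p: "degree p > 0" and "open U"
  shows "open (sphere_map p -` U)"
proof -
  have *: "open (Fin ` (poly p -` (Fin -` U)))"
    by (intro open_Fin_image continuous_open_vimage open_vimage_Fin \<open>open U\<close>) (auto intro: continuous_intros)
  show ?thesis
  proof (cases "Infty \<in> U")
    case True
    obtain R where R: "insert Infty (Fin ` {z. R < cmod z}) \<subseteq> U"
      using open_Infty_contains[OF \<open>open U\<close> True] .
    obtain r where r: "\<forall>z. r \<le> cmod z \<longrightarrow> R + 1 \<le> cmod (poly p z)" using poly_large[OF p] by blast
    have "sphere_map p -` U = Fin ` (poly p -` (Fin -` U)) \<union> insert Infty (Fin ` {z. r < cmod z})"
    proof (intro set_eqI)
      fix x show "x \<in> sphere_map p -` U \<longleftrightarrow> x \<in> Fin ` (poly p -` (Fin -` U)) \<union> insert Infty (Fin ` {z. r < cmod z})"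
      proof (cases x)
        case (Fin z)
        have "Fin (poly p z) \<in> U" if "r < cmod z"
        proof -
          have "R < cmod (poly p z)" using r that by (smt (verit))
          then show ?thesis using R by auto
        qed
        then show ?thesis using Fin by auto
      qed (use p True in auto)
    qed
    then show ?thesis using * open_Infty_nhd by (simp only: open_Un)
  next
    case False
    then have "U \<subseteq> range Fin" by (auto simp: range_Fin)
    then have "sphere_map p -` U = Fin ` (poly p -` (Fin -` U))"
      using sphere_map_vimage_Fin_image[OF p, of "Fin -` U"] image_vimage_Fin by metis
    then show ?thesis using * by simp
  qed
qed

lemma continuous_on_sphere_map:
  assumes "degree p > 0"
  shows "continuous_on S (sphere_map p)"
proof -
  have "continuous_on UNIV (sphere_map p)"
    using open_sphere_map_vimage[OF assms] by (simp add: continuous_on_open_vimage)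
  then show ?thesis using continuous_on_subset by blast
qed

lemma open_sphere_map_image:
  assumes p: "degree p > 0" and "open U"
  shows "open (sphere_map p ` U)"
proof -
  have *: "open (Fin ` (poly p ` (Fin -` U)))"
    by (intro open_Fin_image poly_open_map p open_vimage_Fin \<open>open U\<close>)
  show ?thesis
  proof (cases "Infty \<in> U")
    case True
    obtain R where R: "insert Infty (Fin ` {z. R < cmod z}) \<subseteq> U"
      using open_Infty_contains[OF \<open>open U\<close> True] .
    have "compact (poly p ` cball 0 R)" by (intro compact_continuous_image continuous_intros compact_cball)
    \<comment> \<open>A value of modulus above \<open>M\<close> is not taken on the disc of radius
      \<open>R\<close>, so all its preimages lie in the part of \<open>U\<close> near
      infinity.\<close>
    then obtain M where M: "\<And>z. cmod z \<le> R \<Longrightarrow> cmod (poly p z) \<le> M"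
      using compact_imp_bounded[of "poly p ` cball 0 R"] unfolding bounded_iff by force
    have far: "Fin w \<in> sphere_map p ` U" if w: "M < cmod w" for w
    proof -
      obtain z where z: "poly p z = w" using surj_poly[OF p] by blast
      then have "R < cmod z" using M[of z] w by force
      then have "Fin z \<in> U" using R by auto
      then show ?thesis using z by (metis image_eqI sphere_map.simps(1))
    qed
    have "sphere_map p ` U = Fin ` (poly p ` (Fin -` U)) \<union> insert Infty (Fin ` {w. M < cmod w})"
    proof (intro equalityI subsetI)
      fix y assume "y \<in> sphere_map p ` U"
      then obtain x where "x \<in> U" "y = sphere_map p x" by blast
      then show "y \<in> Fin ` (poly p ` (Fin -` U)) \<union> insert Infty (Fin ` {w. M < cmod w})"
        using p by (cases x) auto
    next
      fix y assume y: "y \<in> Fin ` (poly p ` (Fin -` U)) \<union> insert Infty (Fin ` {w. M < cmod w})"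
      then consider z where "Fin z \<in> U" "y = sphere_map p (Fin z)" | "y = sphere_map p Infty" | w where "M < cmod w" "y = Fin w"
        using p by fastforce
      then show "y \<in> sphere_map p ` U" by cases (use True far in \<open>blast+\<close>)
    qed
    then show ?thesis using * open_Infty_nhd by (simp only: open_Un)
  next
    case False
    then have "U \<subseteq> range Fin" by (auto simp: range_Fin)
    then have "sphere_map p ` U = sphere_map p ` Fin ` (Fin -` U)" by (simp only: image_vimage_Fin)
    also have "\<dots> = Fin ` (poly p ` (Fin -` U))" by (simp only: image_image sphere_map.simps)
    finally show ?thesis using * by simp
  qed
qed

lemma closed_sphere_map_image:
  assumes "degree p > 0" "closed A"
  shows "closed (sphere_map p ` A)"
  by (rule compact_imp_closed[OF compact_continuous_image[OF continuous_on_sphere_map[OF assms(1)]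
          compact_if_closed_sphere[OF assms(2)]]])

text \<open>The map is open and closed, so the image of a clopen piece of the preimage is clopen in
  the connected set \<open>K\<close>.\<close>

lemma sphere_map_clopen_piece:
  assumes p: "degree p > 0" and K: "connected K" "closed K"
    and A: "openin (top_of_set (sphere_map p -` K)) A" "closedin (top_of_set (sphere_map p -` K)) A" "A \<noteq> {}"
  shows "sphere_map p ` A = K"
proof -
  obtain T where T: "open T" "A = sphere_map p -` K \<inter> T" using A by (auto simp: openin_open)
  have "sphere_map p ` A = K \<inter> sphere_map p ` T" using T by auto
  then have op: "openin (top_of_set K) (sphere_map p ` A)"
    using open_sphere_map_image[OF p T(1)] by (auto simp: openin_open)
  have "closed (sphere_map p -` K)"
    using open_sphere_map_vimage[OF p, of "- K"] K by (simp add: closed_def vimage_Compl)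
  then have "closed A" using A closedin_closed_trans by blast
  then have "closedin (top_of_set K) (sphere_map p ` A)"
    by (intro closed_subset openin_imp_subset[OF op] closed_sphere_map_image[OF p])
  then show ?thesis using op K A(3) unfolding connected_clopen by blast
qed

text \<open>A point \<open>b\<close> outside \<open>U\<close> is sent to infinity, which moves
  \<open>U\<close> into the plane. There it suffices that no component of the complement is
  bounded.\<close>

lemma simply_connected_if_connected_complement:
  fixes U :: "riemann_sphere set"
  assumes "open U" "connected U" "connected (- U)"
  shows "simply_connected U"
proof (cases "U = UNIV")
  case False
  then obtain b where b: "b \<notin> U" by blast
  have "(sphere (0 :: complex \<times> real) 1 - {stereo b}) homeomorphic (UNIV :: complex set)"
    using stereo_on_sphere[of b] by (intro homeomorphic_punctured_sphere_affine) auto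
  moreover have "- {b} homeomorphic sphere 0 1 - {stereo b}"
  proof -
    have "stereo ` (- {b}) = sphere 0 1 - {stereo b}"
      using inj_stereo by (simp add: Compl_eq_Diff_UNIV image_set_diff range_stereo)
    then have "homeomorphism (- {b}) (sphere 0 1 - {stereo b}) stereo (inv stereo)"
      by (intro homeomorphism_of_subsets[OF homeomorphism_stereo]) auto
    then show ?thesis by (auto simp: homeomorphic_def)
  qed
  ultimately have "- {b} homeomorphic (UNIV :: complex set)" using homeomorphic_trans by blast
  then obtain f g where hom: "homeomorphism (- {b}) (UNIV :: complex set) f g"
    by (auto simp: homeomorphic_def)
  have fg: "f (g w) = w" "g w \<noteq> b" for w using hom by (auto simp: homeomorphism_def)
  have gf: "g (f x) = x" if "x \<noteq> b" for x using hom that by (auto simp: homeomorphism_def)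
  have contg: "continuous_on UNIV g" using hom by (simp add: homeomorphism_def)
  have contf: "continuous_on (- {b}) f" using hom by (simp add: homeomorphism_def)
  define V where "V = f ` U"
  have UV: "U homeomorphic V"
    using homeomorphism_of_subsets[OF hom, of U V] b by (auto simp: V_def homeomorphic_def)
  have V_eq: "V = g -` U"
  proof
    show "V \<subseteq> g -` U" using b gf by (metis V_def image_subset_iff vimageI)
    show "g -` U \<subseteq> V" using fg(1) by (metis V_def imageI subsetI vimageE)
  qed
  have "open V" unfolding V_eq using contg \<open>open U\<close> by (simp add: continuous_on_open_vimage)
  moreover have "connected V" using UV \<open>connected U\<close> homeomorphic_connectedness by blast
  moreover have "\<not> bounded C" if C: "C \<in> components (- V)" for C
  proof
    assume "bounded C"
    have clV: "closed (- V)" using \<open>open V\<close> by (simp add: closed_Compl)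
    have "compact C" using \<open>bounded C\<close> closed_components[OF clV C] by (simp add: compact_eq_bounded_closed)
    \<comment> \<open>By the Sura-Bura theorem a compact component sits in a compact clopen piece
      \<open>K\<close> of the complement. Back on the sphere this piece is clopen in
      \<open>- U\<close> but misses \<open>b\<close>.\<close>
    then obtain K where K: "openin (top_of_set (- V)) K" "compact K" "C \<subseteq> K"
      using Sura_Bura_clopen_subset[OF closed_imp_locally_compact[OF clV] C _ open_UNIV] by auto
    have "K \<noteq> {}" using K C in_components_nonempty by fastforce
    obtain T where T: "open T" "K = - V \<inter> T" using K by (auto simp: openin_open)
    have "closed (g ` K)"
      using K contg by (intro compact_imp_closed compact_continuous_image) (auto intro: continuous_on_subset)
    moreover have "g ` K = - U \<inter> g ` T"
    proof -
      have "y \<in> g ` K" if "y \<in> - U" "y \<in> g ` T" for y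
        using that T fg(1) by (auto simp: V_eq)
      then show ?thesis using T by (auto simp: V_eq)
    qed
    moreover have "open (g ` T)"
    proof -
      have "y \<in> g ` T" if "f y \<in> T" "y \<noteq> b" for y
        using gf[OF that(2)] that(1) by (metis imageI)
      then have "g ` T = f -` T \<inter> - {b}" using fg by auto
      then show ?thesis using contf \<open>open T\<close> by (simp add: continuous_on_open_vimage open_Compl)
    qed
    ultimately have "openin (top_of_set (- U)) (g ` K)" "closedin (top_of_set (- U)) (g ` K)"
      by (auto simp: openin_open closedin_closed)
    then have "g ` K = {} \<or> g ` K = - U" using \<open>connected (- U)\<close> unfolding connected_clopen by blast
    then show False using \<open>K \<noteq> {}\<close> fg(2) b by (metis ComplI empty_is_image imageE)
  qed
  ultimately have "simply_connected V"
    using simply_connected_eq_unbounded_complement_components by blast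
  then show ?thesis using UV homeomorphic_simply_connected_eq by blast
qed (use simply_connected_sphere_UNIV in simp)

section \<open>Sequences of polynomials on the Fatou and Julia sets\<close>

lemma uniform_limit_subseq:
  assumes "uniform_limit X f h sequentially" "strict_mono (s :: nat \<Rightarrow> nat)"
  shows "uniform_limit X (\<lambda>n. f (s n)) h sequentially"
  using filterlim_compose[OF assms(1) filterlim_subseq[OF assms(2)]] .

lemma frequently_subseq:
  assumes "\<exists>\<^sub>F n in sequentially. P n"
  obtains s :: "nat \<Rightarrow> nat" where "strict_mono s" "\<And>n. P (s n)"
  using assms infinite_enumerate[of "{n. P n}"]
  by (auto simp: frequently_cofinite simp flip: cofinite_eq_sequentially)

section \<open>Local dichotomy for a uniform limit: bounded or tending to infinity\<close>

context
  fixes f :: "nat \<Rightarrow> complex poly" and h :: "riemann_sphere \<Rightarrow> riemann_sphere" and a :: complex and r :: real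
  assumes deg: "\<And>n. degree (f n) > 0" and r: "r > 0"
    and lim: "uniform_limit (Fin ` cball a r) (\<lambda>n. sphere_map (f n)) h sequentially"
begin

text \<open>A uniform limit of continuous maps is continuous, so on a small disc the limit, and then
  the sequence, stays close to its value at the centre.\<close>

lemma uniform_limit_local:
  assumes "e > 0"
  shows "\<exists>r'>0. r' \<le> r \<and> (\<forall>\<^sub>F n in sequentially. \<forall>z\<in>cball a r'.
           dist (Fin (poly (f n) z)) (h (Fin a)) < e)"
proof -
  have "continuous_on (Fin ` cball a r) h"
    by (rule uniform_limit_theorem[OF _ lim]) (auto intro!: always_eventually continuous_on_sphere_map deg)
  then have "continuous_on (cball a r) (\<lambda>z. h (Fin z))"
    using continuous_on_compose2[OF _ continuous_on_Fin] by blast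
  moreover have "a \<in> cball a r" "e / 2 > 0" using r \<open>e > 0\<close> by auto
  ultimately obtain d where d: "d > 0" "\<And>z. \<lbrakk>z \<in> cball a r; dist z a < d\<rbrakk> \<Longrightarrow> dist (h (Fin z)) (h (Fin a)) < e / 2"
    unfolding continuous_on_iff by metis
  define r' where "r' = min r (d / 2)"
  have r': "r' > 0" "r' \<le> r" "r' < d" using r d by (auto simp: r'_def)
  have "\<forall>\<^sub>F n in sequentially. \<forall>x\<in>Fin ` cball a r. dist (sphere_map (f n) x) (h x) < e / 2"
    using uniform_limitD[OF lim] \<open>e / 2 > 0\<close> by blast
  then have "\<forall>\<^sub>F n in sequentially. \<forall>z\<in>cball a r'. dist (Fin (poly (f n) z)) (h (Fin a)) < e"
  proof eventually_elim
    case (elim n)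
    show ?case
    proof
      fix z assume z: "z \<in> cball a r'"
      then have zr: "z \<in> cball a r" "dist z a < d" using r' by (auto simp: dist_commute)
      have "dist (Fin (poly (f n) z)) (h (Fin z)) < e / 2" using elim zr by auto
      moreover have "dist (h (Fin z)) (h (Fin a)) < e / 2" using d(2)[OF zr] .
      ultimately show "dist (Fin (poly (f n) z)) (h (Fin a)) < e"
        using dist_triangle[of "Fin (poly (f n) z)" "h (Fin a)" "h (Fin z)"] by linarith
    qed
  qed
  with r' show ?thesis by blast
qed

lemma locally_bounded_if_finite_limit:
  assumes "h (Fin a) = Fin b"
  shows "\<exists>r'>0. \<exists>B. \<forall>\<^sub>F n in sequentially. \<forall>z\<in>cball a r'. cmod (poly (f n) z) \<le> B"
proof -
  \<comment> \<open>With half the distance to \<open>Infty\<close>, values within \<open>e\<close>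
    of the limit are at least \<open>e\<close> away from \<open>Infty\<close>, which bounds their
    modulus by \<open>2 / e\<close>.\<close>
  define e where "e = dist (Fin b) Infty / 2"
  have "e > 0" by (simp add: e_def)
  then obtain r' where r': "r' > 0"
    "\<forall>\<^sub>F n in sequentially. \<forall>z\<in>cball a r'. dist (Fin (poly (f n) z)) (Fin b) < e"
    using uniform_limit_local[of e] assms by auto
  from r'(2) have "\<forall>\<^sub>F n in sequentially. \<forall>z\<in>cball a r'. cmod (poly (f n) z) \<le> 2 / e"
  proof eventually_elim
    case (elim n)
    show ?case
    proof (rule ballI, rule ccontr)
      fix z assume z: "z \<in> cball a r'" and "\<not> cmod (poly (f n) z) \<le> 2 / e"
      then have "dist (Fin (poly (f n) z)) Infty < e"
        using dist_Fin_Infty_less[OF \<open>e > 0\<close>] by simp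
      moreover have "dist (Fin (poly (f n) z)) (Fin b) < e" using elim z by blast
      ultimately show False
        using dist_triangle[of "Fin b" Infty "Fin (poly (f n) z)"] by (simp add: e_def dist_commute)
    qed
  qed
  with r'(1) show ?thesis by blast
qed

text \<open>Hurwitz's theorem for the reciprocals: a limit of zero-free functions with a zero vanishes
  identically.\<close>

lemma locally_large_if_infinite_limit:
  assumes "h (Fin a) = Infty"
  shows "\<exists>r'>0. \<forall>B. \<forall>\<^sub>F n in sequentially. \<forall>z\<in>cball a r'. B \<le> cmod (poly (f n) z)"
proof -
  obtain r1 where r1: "r1 > 0"
    "\<forall>\<^sub>F n in sequentially. \<forall>z\<in>cball a r1. dist (Fin (poly (f n) z)) Infty < 1"
    using uniform_limit_local[of 1] assms by auto
  \<comment> \<open>Points of modulus at most 1 have chordal distance at least sqrt 2 from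
    \<open>Infty\<close>. So the reciprocals are eventually bounded by 1 on the disc, as Montel's
    theorem requires.\<close>
  have big: "\<forall>\<^sub>F n in sequentially. \<forall>z\<in>cball a r1. 1 < cmod (poly (f n) z)"
    using r1(2)
  proof eventually_elim
    case (elim n)
    show ?case
    proof (rule ballI, rule ccontr)
      fix z assume z: "z \<in> cball a r1" and "\<not> 1 < cmod (poly (f n) z)"
      then have "2 / sqrt (1 + 1\<^sup>2) \<le> dist (Fin (poly (f n) z)) Infty"
        by (intro dist_Fin_Infty_ge) simp
      moreover have "1 < 2 / sqrt (1 + 1\<^sup>2 :: real)" by (simp add: real_less_lsqrt)
      ultimately show False using elim[rule_format, OF z] by linarith
    qed
  qed
  \<comment> \<open>The halved closed disc is a compact subset of \<open>ball a r1\<close>, where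
    convergence from Montel's theorem is uniform.\<close>
  have "\<forall>\<^sub>F n in sequentially. \<forall>z\<in>cball a (r1 / 2). B \<le> cmod (poly (f n) z)" for B
  proof (rule ccontr)
    assume "\<not> (\<forall>\<^sub>F n in sequentially. \<forall>z\<in>cball a (r1 / 2). B \<le> cmod (poly (f n) z))"
    then have "\<exists>\<^sub>F n in sequentially. \<exists>z\<in>cball a (r1 / 2). cmod (poly (f n) z) < B"
      by (auto simp: not_eventually not_le)
    from frequently_eventually_conj[OF this big]
    obtain s :: "nat \<Rightarrow> nat" where s: "strict_mono s"
      "\<And>n. (\<forall>z\<in>cball a r1. 1 < cmod (poly (f (s n)) z)) \<and>
           (\<exists>z\<in>cball a (r1 / 2). cmod (poly (f (s n)) z) < B)"
      by (rule frequently_subseq) blast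
    define F where "F = (\<lambda>n z. inverse (poly (f (s n)) z))"
    have nz: "poly (f (s n)) z \<noteq> 0" if "z \<in> cball a r1" for n z
      using s(2)[of n] that by force
    have F1: "cmod (F n z) \<le> 1" if "z \<in> ball a r1" for n z
    proof -
      have "1 < cmod (poly (f (s n)) z)" using s(2)[of n] that by auto
      then show ?thesis by (simp add: F_def norm_inverse inverse_le_1_iff)
    qed
    define H where "H = {h. h holomorphic_on ball a r1 \<and> (\<forall>z\<in>ball a r1. cmod (h z) \<le> 1)}"
    have FH: "F n \<in> H" for n
      using F1[of _ n] nz[of _ n] by (auto simp: H_def F_def intro!: holomorphic_intros)
    obtain g t where g: "g holomorphic_on ball a r1" "strict_mono (t :: nat \<Rightarrow> nat)"
      "\<And>x. x \<in> ball a r1 \<Longrightarrow> (\<lambda>n. F (t n) x) \<longlonglongrightarrow> g x"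
      "\<And>K. \<lbrakk>compact K; K \<subseteq> ball a r1\<rbrakk> \<Longrightarrow> uniform_limit K (F \<circ> t) g sequentially"
    proof (rule Montel[of "ball a r1" H F])
      show "\<exists>B. \<forall>h\<in>H. \<forall>z\<in>K. cmod (h z) \<le> B" if "compact K" "K \<subseteq> ball a r1" for K
        using that by (intro exI[of _ 1]) (auto simp: H_def)
    qed (use FH in \<open>auto simp: H_def\<close>)
    have aB: "a \<in> ball a r1" using r1 by simp
    have "(\<lambda>n. F (t n) a) \<longlonglongrightarrow> 0"
      unfolding tendsto_iff dist_0_norm dist_norm
    proof (intro allI impI)
      fix e :: real assume "e > 0"
      \<comment> \<open>\<open>d\<close> is the chordal distance from \<open>Infty\<close> of the
        points of modulus \<open>1 / e\<close>.\<close>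
      define d where "d = 2 / sqrt (1 + (1 / e)\<^sup>2)"
      have "d > 0" by (auto simp: d_def intro!: divide_pos_pos add_pos_nonneg)
      have st: "strict_mono (s \<circ> t)" using s(1) g(2) by (rule strict_mono_o)
      obtain r' where r': "r' > 0"
        "\<forall>\<^sub>F n in sequentially. \<forall>z\<in>cball a r'. dist (Fin (poly (f n) z)) Infty < d"
        using uniform_limit_local[OF \<open>d > 0\<close>] assms by auto
      have "\<forall>\<^sub>F n in sequentially. \<forall>z\<in>cball a r'. dist (Fin (poly (f (s (t n))) z)) Infty < d"
        using eventually_subseq[OF st r'(2)] by simp
      then show "\<forall>\<^sub>F n in sequentially. cmod (F (t n) a - 0) < e"
      proof eventually_elim
        case (elim n)
        then have "dist (Fin (poly (f (s (t n))) a)) Infty < d" using r'(1) by auto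
        then have "\<not> cmod (poly (f (s (t n))) a) \<le> 1 / e"
          using dist_Fin_Infty_ge[of "poly (f (s (t n))) a" "1 / e"] by (auto simp: d_def)
        then have gt: "1 / e < cmod (poly (f (s (t n))) a)" by simp
        have "inverse (cmod (poly (f (s (t n))) a)) < inverse (1 / e)"
          using gt \<open>e > 0\<close> by (intro less_imp_inverse_less) auto
        then show ?case by (simp add: F_def norm_inverse)
      qed
    qed
    then have "g a = 0" using g(3)[OF aB] LIMSEQ_unique by blast
    have "g constant_on ball a r1"
    proof (rule ccontr)
      assume "\<not> g constant_on ball a r1"
      then have "g a \<noteq> 0"
        using nz aB FH g
        by (intro Hurwitz_no_zeros[of "ball a r1" "F \<circ> t" g]) (auto simp: H_def F_def)
      with \<open>g a = 0\<close> show False by simp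
    qed
    then have g0: "g z = 0" if "z \<in> ball a r1" for z
      using that aB \<open>g a = 0\<close> by (auto simp: constant_on_def)
    have sub: "cball a (r1 / 2) \<subseteq> ball a r1" using r1(1) by auto
    define B' where "B' = max B 1"
    have "\<forall>\<^sub>F n in sequentially. \<forall>z\<in>cball a (r1 / 2). dist ((F \<circ> t) n z) (g z) < 1 / B'"
      by (rule uniform_limitD[OF g(4)]) (use sub in \<open>auto simp: B'_def\<close>)
    then obtain n where n: "\<forall>z\<in>cball a (r1 / 2). dist ((F \<circ> t) n z) (g z) < 1 / B'"
      using eventually_happens'[OF sequentially_bot] by blast
    obtain z where z: "z \<in> cball a (r1 / 2)" "cmod (poly (f (s (t n))) z) < B"
      using s(2) by blast
    have "g z = 0" using z(1) sub g0 by blast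
    then have "cmod (F (t n) z) < 1 / B'" using bspec[OF n z(1)] by simp
    then have "inverse (cmod (poly (f (s (t n))) z)) < inverse B'"
      by (simp add: F_def norm_divide inverse_eq_divide)
    then have "B' < cmod (poly (f (s (t n))) z)"
      by (rule inverse_less_imp_less) (use nz[of z "t n"] z sub in auto)
    then show False using z by (simp add: B'_def)
  qed
  then show ?thesis using r1(1) by (intro exI[of _ "r1 / 2"]) auto
qed

end

text \<open>The consequence of normality that the level set argument uses. The bound
  \<open>M\<close> is common to all \<open>n\<close>, while the index from which a level is avoided
  may depend on \<open>R\<close>; this covers bounded sequences and those tending to infinity
  alike.\<close>

definition avoids_levels :: "(nat \<Rightarrow> complex poly) \<Rightarrow> complex set \<Rightarrow> bool" where
  "avoids_levels f S \<longleftrightarrow> (\<exists>M. \<forall>R>M. \<forall>\<^sub>F n in sequentially. \<forall>z\<in>S. cmod (poly (f n) z) \<noteq> R)"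

lemma avoids_levels_Un:
  assumes "avoids_levels f S" "avoids_levels f T"
  shows "avoids_levels f (S \<union> T)"
proof -
  obtain M N where
    M: "\<And>R. R > M \<Longrightarrow> \<forall>\<^sub>F n in sequentially. \<forall>z\<in>S. cmod (poly (f n) z) \<noteq> R" and
    N: "\<And>R. R > N \<Longrightarrow> \<forall>\<^sub>F n in sequentially. \<forall>z\<in>T. cmod (poly (f n) z) \<noteq> R"
    using assms unfolding avoids_levels_def by blast
  have "\<forall>\<^sub>F n in sequentially. \<forall>z\<in>S \<union> T. cmod (poly (f n) z) \<noteq> R" if "R > max M N" for R
  proof -
    have "R > M" "R > N" using that by auto
    from M[OF this(1)] N[OF this(2)] show ?thesis by eventually_elim blast
  qed
  then show ?thesis unfolding avoids_levels_def by blast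
qed

lemma avoids_levels_subset:
  assumes "avoids_levels f T" "S \<subseteq> T"
  shows "avoids_levels f S"
proof -
  obtain M where M: "\<And>R. R > M \<Longrightarrow> \<forall>\<^sub>F n in sequentially. \<forall>z\<in>T. cmod (poly (f n) z) \<noteq> R"
    using assms unfolding avoids_levels_def by blast
  have "\<forall>\<^sub>F n in sequentially. \<forall>z\<in>S. cmod (poly (f n) z) \<noteq> R" if "R > M" for R
    using M[OF that] by eventually_elim (use assms(2) in blast)
  then show ?thesis unfolding avoids_levels_def by blast
qed

text \<open>Near a finite limit value all levels above a local bound are avoided; near an infinite
  one every fixed level is eventually exceeded.\<close>

lemma avoids_levels_if_uniform_limit:
  assumes deg: "\<And>n. degree (f n) > 0" and "r > 0"
    and lim: "uniform_limit (Fin ` cball a r) (\<lambda>n. sphere_map (f n)) h sequentially"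
  shows "\<exists>r'>0. avoids_levels f (cball a r')"
proof (cases "h (Fin a)")
  case (Fin b)
  obtain r' B where r': "r' > 0" "\<forall>\<^sub>F n in sequentially. \<forall>z\<in>cball a r'. cmod (poly (f n) z) \<le> B"
    using locally_bounded_if_finite_limit[OF deg \<open>r > 0\<close> lim Fin] by blast
  have "\<forall>\<^sub>F n in sequentially. \<forall>z\<in>cball a r'. cmod (poly (f n) z) \<noteq> R" if "R > B" for R
    using r'(2) by eventually_elim (use that in fastforce)
  then show ?thesis using r'(1) unfolding avoids_levels_def by blast
next
  case Infty
  obtain r' where r': "r' > 0" "\<And>B. \<forall>\<^sub>F n in sequentially. \<forall>z\<in>cball a r'. B \<le> cmod (poly (f n) z)"
    using locally_large_if_infinite_limit[OF deg \<open>r > 0\<close> lim Infty] by blast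
  have "\<forall>\<^sub>F n in sequentially. \<forall>z\<in>cball a r'. cmod (poly (f n) z) \<noteq> R" for R
    using r'(2)[of "R + 1"] by eventually_elim fastforce
  then show ?thesis using r'(1) unfolding avoids_levels_def by blast
qed

text \<open>Compactness reduces the claim to finitely many normal neighbourhoods, on which
  subsequences are extracted one after the other.\<close>

lemma Fatou_subseq:
  assumes S: "compact S" "Fin ` S \<subseteq> Fatou G" and f: "range f \<subseteq> G"
  shows "\<exists>s. strict_mono (s :: nat \<Rightarrow> nat) \<and>
           (\<forall>a\<in>S. \<exists>r>0. \<exists>h. uniform_limit (Fin ` cball a r) (\<lambda>n. sphere_map (f (s n))) h sequentially)"
proof -
  \<comment> \<open>Discs of radius \<open>\<rho> a\<close> will cover \<open>S\<close>, but
    convergence is arranged on the doubled discs: each covered point then has a whole disc of radius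
    \<open>\<rho> a\<close> inside.\<close>
  have "\<exists>\<rho>>0. \<exists>U. Fin ` cball a (2 * \<rho>) \<subseteq> U \<and> normal_family_on (sphere_map ` G) U" if "a \<in> S" for a
  proof -
    obtain U where U: "open U" "Fin a \<in> U" "normal_family_on (sphere_map ` G) U"
      using S(2) \<open>a \<in> S\<close> by (auto simp: Fatou_def)
    then obtain e where "e > 0" "cball a e \<subseteq> Fin -` U"
      using open_vimage_Fin[OF U(1)] by (meson open_contains_cball vimageI)
    then show ?thesis using U(3) by (intro exI[of _ "e / 2"]) auto
  qed
  then obtain \<rho> U where \<rho>: "\<And>a. a \<in> S \<Longrightarrow> \<rho> a > 0" "\<And>a. a \<in> S \<Longrightarrow> Fin ` cball a (2 * \<rho> a) \<subseteq> U a"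
    "\<And>a. a \<in> S \<Longrightarrow> normal_family_on (sphere_map ` G) (U a)"
    by metis
  have "S \<subseteq> (\<Union>a\<in>S. ball a (\<rho> a))" using \<rho>(1) by auto
  then obtain F where F: "F \<subseteq> S" "finite F" "S \<subseteq> (\<Union>a\<in>F. ball a (\<rho> a))"
    using compactE_image[OF S(1), of S "\<lambda>a. ball a (\<rho> a)"] by auto
  have "\<exists>s. strict_mono (s :: nat \<Rightarrow> nat) \<and>
      (\<forall>a\<in>F. \<exists>h. uniform_limit (Fin ` cball a (2 * \<rho> a)) (\<lambda>n. sphere_map (f (s n))) h sequentially)"
    using F(2,1)
  proof (induction F)
    case empty
    show ?case by (intro exI[of _ id]) (simp add: strict_mono_def)
  next
    case (insert b F)
    then obtain s where s: "strict_mono (s :: nat \<Rightarrow> nat)"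
      "\<And>a. a \<in> F \<Longrightarrow> \<exists>h. uniform_limit (Fin ` cball a (2 * \<rho> a)) (\<lambda>n. sphere_map (f (s n))) h sequentially"
      by auto
    have "b \<in> S" using insert by auto
    have "range (\<lambda>n. sphere_map (f (s n))) \<subseteq> sphere_map ` G" using f by auto
    from \<rho>(3)[OF \<open>b \<in> S\<close>, unfolded normal_family_on_def, rule_format, OF this]
    obtain t h where t: "strict_mono (t :: nat \<Rightarrow> nat)"
      "\<And>K. \<lbrakk>compact K; K \<subseteq> U b\<rbrakk> \<Longrightarrow> uniform_limit K (\<lambda>n. sphere_map (f (s (t n)))) h sequentially"
      by auto
    have "uniform_limit (Fin ` cball b (2 * \<rho> b)) (\<lambda>n. sphere_map (f (s (t n)))) h sequentially"
      by (intro t(2) compact_Fin_image compact_cball \<rho>(2)[OF \<open>b \<in> S\<close>])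
    moreover have "\<exists>h. uniform_limit (Fin ` cball a (2 * \<rho> a)) (\<lambda>n. sphere_map (f (s (t n)))) h sequentially"
      if "a \<in> F" for a
      using s(2)[OF that] uniform_limit_subseq[OF _ t(1)] by blast
    ultimately show ?case
      using strict_mono_o[OF s(1) t(1), unfolded o_def] by (intro exI[of _ "\<lambda>n. s (t n)"]) auto
  qed
  then obtain s where s: "strict_mono (s :: nat \<Rightarrow> nat)"
    "\<And>a. a \<in> F \<Longrightarrow> \<exists>h. uniform_limit (Fin ` cball a (2 * \<rho> a)) (\<lambda>n. sphere_map (f (s n))) h sequentially"
    by blast
  have "\<exists>r>0. \<exists>h. uniform_limit (Fin ` cball x r) (\<lambda>n. sphere_map (f (s n))) h sequentially" if "x \<in> S" for x
  proof -
    obtain a where a: "a \<in> F" "x \<in> ball a (\<rho> a)" using F(3) \<open>x \<in> S\<close> by blast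
    then obtain h where h: "uniform_limit (Fin ` cball a (2 * \<rho> a)) (\<lambda>n. sphere_map (f (s n))) h sequentially"
      using s(2) by blast
    have "cball x (\<rho> a) \<subseteq> cball a (2 * \<rho> a)"
    proof
      fix y assume "y \<in> cball x (\<rho> a)"
      then show "y \<in> cball a (2 * \<rho> a)" using a(2) dist_triangle[of a y x] by auto
    qed
    then have "uniform_limit (Fin ` cball x (\<rho> a)) (\<lambda>n. sphere_map (f (s n))) h sequentially"
      by (intro uniform_limit_on_subset[OF h] image_mono)
    then show ?thesis using \<rho>(1)[of a] a(1) F(1) by blast
  qed
  with s(1) show ?thesis by blast
qed

text \<open>Local avoidance around each point combines over a finite subcover, where the largest of
  finitely many bounds serves.\<close>

lemma Fatou_avoids_levels:
  assumes S: "compact S" "Fin ` S \<subseteq> Fatou G" and f: "range f \<subseteq> G"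
    and deg: "\<And>g. g \<in> G \<Longrightarrow> degree g > 0"
  obtains s where "strict_mono (s :: nat \<Rightarrow> nat)" "avoids_levels (f \<circ> s) S"
proof -
  obtain s where s: "strict_mono (s :: nat \<Rightarrow> nat)"
    "\<And>a. a \<in> S \<Longrightarrow> \<exists>r>0. \<exists>h. uniform_limit (Fin ` cball a r) (\<lambda>n. sphere_map (f (s n))) h sequentially"
    using Fatou_subseq[OF S f] by blast
  have d: "degree ((f \<circ> s) n) > 0" for n using f deg by auto
  have "\<exists>r>0. avoids_levels (f \<circ> s) (cball a r)" if a: "a \<in> S" for a
  proof -
    obtain r h where "r > 0" "uniform_limit (Fin ` cball a r) (\<lambda>n. sphere_map ((f \<circ> s) n)) h sequentially"
      using s(2)[OF a] by auto
    from avoids_levels_if_uniform_limit[where f = "f \<circ> s", OF d this] show ?thesis .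
  qed
  then obtain r where r: "\<And>a. a \<in> S \<Longrightarrow> r a > 0 \<and> avoids_levels (f \<circ> s) (cball a (r a))" by metis
  have "S \<subseteq> (\<Union>a\<in>S. ball a (r a))" using r by auto
  then obtain F where F: "F \<subseteq> S" "finite F" "S \<subseteq> (\<Union>a\<in>F. ball a (r a))"
    using compactE_image[OF S(1), of S "\<lambda>a. ball a (r a)"] by auto
  have "avoids_levels (f \<circ> s) (\<Union>a\<in>F. cball a (r a))"
    using F(2,1)
  proof (induction F)
    case empty
    show ?case by (simp add: avoids_levels_def)
  qed (use r in \<open>auto intro!: avoids_levels_Un\<close>)
  moreover have "S \<subseteq> (\<Union>a\<in>F. cball a (r a))"
    by (rule order_trans[OF F(3)]) (intro UN_mono ball_subset_cball order_refl)
  ultimately have "avoids_levels (f \<circ> s) S" by (rule avoids_levels_subset)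
  with s(1) show thesis by (rule that)
qed

text \<open>The condition that \<open>normal_family_on\<close> imposes on a single sequence, for a
  region of the plane seen in the sphere.\<close>

definition subconverges_on :: "(nat \<Rightarrow> complex poly) \<Rightarrow> complex set \<Rightarrow> bool" where
  "subconverges_on f B \<longleftrightarrow> (\<exists>s h. strict_mono (s :: nat \<Rightarrow> nat) \<and>
     (\<forall>K. compact K \<and> K \<subseteq> Fin ` B \<longrightarrow> uniform_limit K (\<lambda>n. sphere_map (f (s n))) h sequentially))"

lemma subconverges_on_subseq:
  assumes "subconverges_on (f \<circ> s) B" "strict_mono s"
  shows "subconverges_on f B"
proof -
  obtain t h where t: "strict_mono (t :: nat \<Rightarrow> nat)"
    "\<forall>K. compact K \<and> K \<subseteq> Fin ` B \<longrightarrow> uniform_limit K (\<lambda>n. sphere_map (f (s (t n)))) h sequentially"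
    using assms(1) unfolding subconverges_on_def o_def by blast
  then show ?thesis
    using strict_mono_o[OF assms(2) t(1)] unfolding subconverges_on_def o_def by blast
qed

lemma Julia_not_subconverges:
  assumes "Fin a \<in> Julia G" "e > 0"
  obtains f where "range f \<subseteq> G" "\<not> subconverges_on f (ball a e)"
proof -
  have "\<not> normal_family_on (sphere_map ` G) (Fin ` ball a e)"
    using assms open_Fin_image[OF open_ball, of a e] by (auto simp: Julia_def Fatou_def)
  then have "\<exists>\<phi> :: nat \<Rightarrow> riemann_sphere \<Rightarrow> riemann_sphere. range \<phi> \<subseteq> sphere_map ` G \<and>
      \<not> (\<exists>s h. strict_mono (s :: nat \<Rightarrow> nat) \<and>
       (\<forall>K. compact K \<and> K \<subseteq> Fin ` ball a e \<longrightarrow> uniform_limit K (\<lambda>n. \<phi> (s n)) h sequentially))"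
    unfolding normal_family_on_def not_all not_imp .
  then obtain \<phi> :: "nat \<Rightarrow> riemann_sphere \<Rightarrow> riemann_sphere" where
    \<phi>: "range \<phi> \<subseteq> sphere_map ` G \<and>
      \<not> (\<exists>s h. strict_mono (s :: nat \<Rightarrow> nat) \<and>
       (\<forall>K. compact K \<and> K \<subseteq> Fin ` ball a e \<longrightarrow> uniform_limit K (\<lambda>n. \<phi> (s n)) h sequentially))" ..
  have "\<exists>g\<in>G. \<phi> n = sphere_map g" for n using conjunct1[OF \<phi>] by auto
  then obtain f where f: "\<And>n. f n \<in> G" "\<And>n. \<phi> n = sphere_map (f n)" by metis
  show thesis
  proof (rule that)
    show "range f \<subseteq> G" using f by auto
    show "\<not> subconverges_on f (ball a e)"
      using conjunct2[OF \<phi>] unfolding subconverges_on_def f(2) .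
  qed
qed

text \<open>Montel's theorem gives a limit in the plane, and \<open>Fin\<close> is Lipschitz with
  constant 2 from the Euclidean to the chordal metric.\<close>

lemma subconverges_if_bounded:
  assumes "\<exists>\<^sub>F n in sequentially. \<forall>z\<in>ball a e. cmod (poly (f n) z) \<le> R"
  shows "subconverges_on f (ball a e)"
proof -
  obtain s :: "nat \<Rightarrow> nat" where s: "strict_mono s" "\<And>n. \<forall>z\<in>ball a e. cmod (poly (f (s n)) z) \<le> R"
    using frequently_subseq[OF assms] by blast
  define H where "H = {h. h holomorphic_on ball a e \<and> (\<forall>z\<in>ball a e. cmod (h z) \<le> R)}"
  obtain g t where g: "g holomorphic_on ball a e" "strict_mono (t :: nat \<Rightarrow> nat)"
    "\<And>K. \<lbrakk>compact K; K \<subseteq> ball a e\<rbrakk> \<Longrightarrow> uniform_limit K ((\<lambda>n. poly (f (s n))) \<circ> t) g sequentially"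
  proof (rule Montel[of "ball a e" H "\<lambda>n. poly (f (s n))"])
    show "\<exists>B. \<forall>h\<in>H. \<forall>z\<in>K. cmod (h z) \<le> B" if "compact K" "K \<subseteq> ball a e" for K
      using that by (intro exI[of _ R]) (auto simp: H_def)
  qed (use s(2) in \<open>auto simp: H_def intro!: holomorphic_intros\<close>)
  have "uniform_limit K (\<lambda>n. sphere_map (f ((s \<circ> t) n))) (\<lambda>x. Fin (g (plane_coord x))) sequentially"
    if K: "compact K" "K \<subseteq> Fin ` ball a e" for K
  proof (rule uniform_limitI)
    fix d :: real assume "d > 0"
    have Kr: "K \<subseteq> range Fin" using K by auto
    have "compact (Fin -` K)" using compact_vimage_Fin[OF Kr compact_imp_closed[OF K(1)]] .
    moreover have "Fin -` K \<subseteq> ball a e" using K(2) by auto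
    ultimately have "\<forall>\<^sub>F n in sequentially. \<forall>z\<in>Fin -` K. dist (((\<lambda>n. poly (f (s n))) \<circ> t) n z) (g z) < d / 2"
      using uniform_limitD[OF g(3)] \<open>d > 0\<close> by (meson half_gt_zero)
    then show "\<forall>\<^sub>F n in sequentially. \<forall>x\<in>K. dist (sphere_map (f ((s \<circ> t) n)) x) (Fin (g (plane_coord x))) < d"
    proof eventually_elim
      case (elim n)
      show ?case
      proof
        fix x assume "x \<in> K"
        then obtain z where z: "x = Fin z" "z \<in> Fin -` K" using Kr by auto
        have "dist (poly (f (s (t n))) z) (g z) < d / 2" using elim z by auto
        then show "dist (sphere_map (f ((s \<circ> t) n)) x) (Fin (g (plane_coord x))) < d"
          using dist_Fin_Fin_le[of "poly (f (s (t n))) z" "g z"] z by simp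
      qed
    qed
  qed
  then show ?thesis using strict_mono_o[OF s(1) g(2)] unfolding subconverges_on_def by blast
qed

lemma subconverges_if_large:
  assumes "\<And>R. R > R0 \<Longrightarrow> \<forall>\<^sub>F n in sequentially. \<forall>z\<in>B. R \<le> cmod (poly (f n) z)"
  shows "subconverges_on f B"
proof -
  have "uniform_limit K (\<lambda>n. sphere_map (f (id n))) (\<lambda>_. Infty) sequentially"
    if K: "compact K" "K \<subseteq> Fin ` B" for K
  proof (rule uniform_limitI)
    fix d :: real assume "d > 0"
    \<comment> \<open>This level exceeds \<open>R0\<close>, so the assumption applies, and exceeds
      \<open>2 / d\<close>, so the values are within \<open>d\<close> of
      \<open>Infty\<close>.\<close>
    have "\<forall>\<^sub>F n in sequentially. \<forall>z\<in>B. max R0 (2 / d) + 1 \<le> cmod (poly (f n) z)"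
      by (rule assms) simp
    then show "\<forall>\<^sub>F n in sequentially. \<forall>x\<in>K. dist (sphere_map (f (id n)) x) Infty < d"
    proof eventually_elim
      case (elim n)
      show ?case
      proof
        fix x assume "x \<in> K"
        then obtain z where z: "x = Fin z" "z \<in> B" using K by auto
        have "max R0 (2 / d) + 1 \<le> cmod (poly (f n) z)" using elim z by blast
        then have "2 / d < cmod (poly (f n) z)" by linarith
        then show "dist (sphere_map (f (id n)) x) Infty < d"
          using dist_Fin_Infty_less[OF \<open>d > 0\<close>] z by simp
      qed
    qed
  qed
  then show ?thesis unfolding subconverges_on_def
    by (intro exI[of _ id] exI[of _ "\<lambda>_. Infty"]) (auto simp: strict_mono_def)
qed

section \<open>Components of the Julia set\<close>

lemma open_Fatou: "open (Fatou G)"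
proof -
  have "Fatou G = \<Union> {U. open U \<and> normal_family_on (sphere_map ` G) U}"
    by (auto simp: Fatou_def)
  then show ?thesis by auto
qed

lemma closed_Julia: "closed (Julia G)"
  by (simp add: Julia_def open_Fatou closed_Compl)

lemma Julia_component:
  assumes "J \<in> Julia_components G"
  shows "J \<in> components (Julia G)" "J \<subseteq> range Fin" "J \<noteq> {}" "closed J" "connected J" "J \<subseteq> Julia G"
    "compact (Fin -` J)" "connected (Fin -` J)" "Fin -` J \<noteq> {}"
proof -
  show J: "J \<in> components (Julia G)" "J \<subseteq> range Fin" using assms by (auto simp: Julia_components_def)
  show "J \<noteq> {}" using in_components_nonempty J by blast
  then show "Fin -` J \<noteq> {}" using image_vimage_Fin[OF J(2)] by (metis image_empty)
  show "connected J" using in_components_connected J by blast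
  then show "connected (Fin -` J)" using connected_vimage_Fin J by blast
  show "closed J" using closed_components closed_Julia J by blast
  then show "compact (Fin -` J)" using compact_vimage_Fin J by blast
  show "J \<subseteq> Julia G" using in_components_subset J by blast
qed

text \<open>A larger connected subset of the planar Julia set would give one on the sphere. This
  makes the Sura-Bura theorem applicable in the plane.\<close>

lemma Julia_component_in_plane:
  assumes "J \<in> Julia_components G"
  shows "Fin -` J \<in> components (Fin -` Julia G)"
  unfolding in_components_maximal
proof (intro conjI allI impI)
  fix D assume D: "D \<noteq> {} \<and> Fin -` J \<subseteq> D \<and> D \<subseteq> Fin -` Julia G \<and> connected D"
  have "J \<subseteq> Fin ` D" using D Julia_component(2)[OF assms] by blast
  moreover have "Fin ` D \<subseteq> Julia G" "Fin ` D \<noteq> {}" using D by auto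
  moreover have "connected (Fin ` D)" using D connected_Fin_image by blast
  ultimately have "Fin ` D = J"
    using Julia_component(1)[OF assms] unfolding in_components_maximal by meson
  then show "D = Fin -` J" by auto
qed (use Julia_component[OF assms] in auto)

lemma component_absorbs:
  assumes "C \<in> components S" "connected T" "T \<subseteq> S" "C \<inter> T \<noteq> {}"
  shows "T \<subseteq> C"
  using assms by (meson components_maximal inf_commute)

lemma components_disjoint:
  assumes "C \<in> components S" "D \<in> components S" "C \<noteq> D"
  shows "C \<inter> D = {}"
  using assms components_nonoverlap by blast

lemma connected_Infty_nhd: "connected (insert Infty (Fin ` {z. R < cmod z}))"
proof (rule connected_intermediate_closure)
  have "{z. R < cmod z} = - cball (0::complex) R" by auto
  moreover have "connected (- cball (0::complex) R)" by (intro connected_complement_bounded_convex) auto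
  ultimately show "connected (Fin ` {z. R < cmod z})" by (metis connected_Fin_image)
  have "Infty \<in> closure (Fin ` {z. R < cmod z})"
    unfolding closure_iff_nhds_not_empty
  proof (intro allI impI)
    fix X V assume V: "V \<subseteq> X" "open V" "Infty \<in> V"
    obtain R' where R': "insert Infty (Fin ` {z. R' < cmod z}) \<subseteq> V" using open_Infty_contains[OF V(2,3)] .
    define t where "t = max (max R R') 0 + 1"
    have "R < t" "R' < t" "0 < t" by (auto simp: t_def)
    then have "Fin (of_real t) \<in> Fin ` {z. R < cmod z} \<inter> Fin ` {z. R' < cmod z}"
      by (intro IntI imageI) auto
    then show "Fin ` {z. R < cmod z} \<inter> X \<noteq> {}" using R' V(1) by blast
  qed
  then show "insert Infty (Fin ` {z. R < cmod z}) \<subseteq> closure (Fin ` {z. R < cmod z})"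
    using closure_subset[of "Fin ` {z. R < cmod z}"] by (simp only: insert_subset)
qed (rule subset_insertI)

text \<open>The sphere is locally connected: discs serve at finite points, exteriors of discs at
  \<open>Infty\<close>.\<close>

lemma open_components_sphere:
  fixes S :: "riemann_sphere set"
  assumes "open S" "C \<in> components S"
  shows "open C"
proof (subst open_subopen, rule ballI)
  fix x assume x: "x \<in> C"
  have CS: "C \<subseteq> S" using in_components_subset[OF assms(2)] .
  have "\<exists>N. open N \<and> x \<in> N \<and> connected N \<and> N \<subseteq> S"
  proof (cases x)
    case (Fin z)
    then obtain e where "e > 0" "ball z e \<subseteq> Fin -` S"
      using open_vimage_Fin[OF assms(1)] x CS by (metis openE subsetD vimageI)
    then show ?thesis using Fin
      by (intro exI[of _ "Fin ` ball z e"]) (auto intro: open_Fin_image connected_Fin_image)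
  next
    case Infty
    then obtain R where "insert Infty (Fin ` {z. R < cmod z}) \<subseteq> S"
      using open_Infty_contains[OF assms(1)] x CS by blast
    then show ?thesis using Infty open_Infty_nhd connected_Infty_nhd by blast
  qed
  then obtain N where N: "open N" "x \<in> N" "connected N" "N \<subseteq> S" by blast
  then have "N \<subseteq> C" using component_absorbs[OF assms(2) N(3,4)] x by blast
  with N show "\<exists>T. open T \<and> x \<in> T \<and> T \<subseteq> C" by blast
qed

text \<open>\<open>inside\<close> is the union of the bounded complementary components, and a
  connected set in it lies in just one of them.\<close>

lemma surrounding_le_iff_inside:
  assumes K: "K1 \<subseteq> range Fin" "connected K1" "K1 \<noteq> {}"
  shows "surrounding_le K1 K2 \<longleftrightarrow> K1 = K2 \<or> Fin -` K1 \<subseteq> inside (Fin -` K2)"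
proof -
  have "(\<exists>C \<in> components (- (Fin -` K2)). bounded C \<and> K1 \<subseteq> Fin ` C) \<longleftrightarrow> Fin -` K1 \<subseteq> inside (Fin -` K2)"
  proof
    assume "\<exists>C \<in> components (- (Fin -` K2)). bounded C \<and> K1 \<subseteq> Fin ` C"
    then obtain C where C: "C \<in> components (- (Fin -` K2))" "bounded C" "K1 \<subseteq> Fin ` C" by blast
    show "Fin -` K1 \<subseteq> inside (Fin -` K2)"
    proof
      fix x assume "x \<in> Fin -` K1"
      then have x: "x \<in> C" using C(3) by auto
      then have "connected_component_set (- (Fin -` K2)) x = C"
        using C(1) by (metis componentsE connected_component_eq)
      moreover have "x \<in> - (Fin -` K2)" using x C(1) in_components_subset by blast
      ultimately show "x \<in> inside (Fin -` K2)" using C(2) by (simp add: inside_def)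
    qed
  next
    assume sub: "Fin -` K1 \<subseteq> inside (Fin -` K2)"
    obtain x where x: "x \<in> Fin -` K1" using K(3) image_vimage_Fin[OF K(1)] by (metis image_empty ex_in_conv)
    define C where "C = connected_component_set (- (Fin -` K2)) x"
    have "x \<notin> Fin -` K2" "bounded C" using sub x by (auto simp: inside_def C_def)
    moreover have "Fin ` (Fin -` K1) \<subseteq> Fin ` C"
      unfolding C_def
    proof (rule image_mono, rule connected_component_maximal[OF x connected_vimage_Fin[OF K(1,2)]])
      show "Fin -` K1 \<subseteq> - Fin -` K2" using sub inside_no_overlap[of "Fin -` K2"] by blast
    qed
    ultimately show "\<exists>C \<in> components (- (Fin -` K2)). bounded C \<and> K1 \<subseteq> Fin ` C"
      unfolding image_vimage_Fin[OF K(1)]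
      by (intro bexI[of _ C]) (auto simp: C_def components_def)
  qed
  then show ?thesis by (simp add: surrounding_le_def)
qed

text \<open>Adding \<open>Infty\<close> to \<open>F\<close> gives a closed, hence compact, subset of
  the sphere, whose image is closed.\<close>

lemma closed_poly_image:
  fixes F :: "complex set"
  assumes "degree p > 0" "closed F"
  shows "closed (poly p ` F)"
proof -
  have "insert Infty (Fin ` F) = - Fin ` (- F)"
  proof (intro set_eqI)
    fix x show "x \<in> insert Infty (Fin ` F) \<longleftrightarrow> x \<in> - Fin ` (- F)" by (cases x) auto
  qed
  moreover have "open (Fin ` (- F))" using assms(2) open_Fin_image by blast
  ultimately have "closed (insert Infty (Fin ` F))" by (simp add: closed_Compl)
  then have "closed (sphere_map p ` insert Infty (Fin ` F))" by (rule closed_sphere_map_image[OF assms(1)])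
  then have "closed (Fin -` (sphere_map p ` insert Infty (Fin ` F)))" by (rule closed_vimage_Fin)
  moreover have "Fin -` (sphere_map p ` insert Infty (Fin ` F)) = poly p ` F"
    using assms(1) by (auto simp: image_image)
  ultimately show ?thesis by simp
qed

section \<open>Level sets of elements of the semigroup near a Julia component\<close>

locale bounded_critical_orbits =
  fixes G :: "complex poly set" and M :: real
  assumes deg_ge_2: "g \<in> G \<Longrightarrow> degree g \<ge> 2"
    and comp: "\<lbrakk>f \<in> G; g \<in> G\<rbrakk> \<Longrightarrow> pcompose f g \<in> G"
    and M_pos: "M > 0"
    and crit: "\<lbrakk>g \<in> G; poly (pderiv g) c = 0\<rbrakk> \<Longrightarrow> cmod (poly g c) < M"
begin

lemma deg: "g \<in> G \<Longrightarrow> degree g > 0"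
  using deg_ge_2[of g] by simp

text \<open>By the chain rule a critical point of \<open>g\<close> is critical for the composite of
  \<open>f\<close> after \<open>g\<close>, which again belongs to \<open>G\<close>.\<close>

lemma crit_image:
  assumes "f \<in> G" "g \<in> G" "poly (pderiv g) c = 0"
  shows "cmod (poly f (poly g c)) < M"
  using crit[OF comp[OF assms(1,2)], of c] assms(3) by (simp add: pderiv_pcompose poly_pcompose)

lemma connected_G_level:
  assumes "g \<in> G" "R \<ge> M"
  shows "connected {z. cmod (poly g z) = R}"
  using connected_level[OF deg[OF assms(1)] M_pos crit[OF assms(1)] assms(2)] by blast

text \<open>Equivalently, \<open>g\<close> maps the Fatou set into itself. A sequence on the open
  set \<open>V\<close> is composed with \<open>g\<close>, which stays in the family and so has a
  convergent subsequence near \<open>x\<close>.\<close>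

lemma Julia_backward_invariant:
  assumes g: "g \<in> G"
  shows "sphere_map g -` Julia G \<subseteq> Julia G"
proof -
  have "sphere_map g x \<in> Fatou G" if "x \<in> Fatou G" for x
  proof -
    obtain U where U: "open U" "x \<in> U" "normal_family_on (sphere_map ` G) U"
      using \<open>x \<in> Fatou G\<close> by (auto simp: Fatou_def)
    obtain e where e: "e > 0" "cball x e \<subseteq> U" using U by (meson open_contains_cball)
    define V where "V = sphere_map g ` ball x e"
    have "open V" unfolding V_def by (intro open_sphere_map_image deg g open_ball)
    moreover have "sphere_map g x \<in> V" using e by (simp add: V_def)
    moreover have "normal_family_on (sphere_map ` G) V"
      unfolding normal_family_on_def
    proof (intro allI impI)
      fix \<phi> :: "nat \<Rightarrow> riemann_sphere \<Rightarrow> riemann_sphere"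
      assume \<phi>: "range \<phi> \<subseteq> sphere_map ` G"
      have "\<phi> n \<circ> sphere_map g \<in> sphere_map ` G" for n
      proof -
        obtain p where "p \<in> G" "\<phi> n = sphere_map p" using \<phi> by blast
        then show ?thesis using sphere_map_pcompose[OF deg[OF g], of p] comp[OF _ g] by (metis imageI)
      qed
      then have "range (\<lambda>n. \<phi> n \<circ> sphere_map g) \<subseteq> sphere_map ` G" by blast
      from U(3)[unfolded normal_family_on_def, rule_format, OF this]
      obtain s h where s: "strict_mono (s :: nat \<Rightarrow> nat)"
        "\<forall>K. compact K \<and> K \<subseteq> U \<longrightarrow> uniform_limit K (\<lambda>n. \<phi> (s n) \<circ> sphere_map g) h sequentially"
        by (elim exE conjE) (rule that)
      have lim: "uniform_limit (cball x e) (\<lambda>n. \<phi> (s n) \<circ> sphere_map g) h sequentially"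
        by (rule s(2)[rule_format, OF conjI[OF compact_if_closed_sphere[OF closed_cball] e(2)]])
      \<comment> \<open>An arbitrary choice of preimages: each estimate at \<open>\<sigma> w\<close>
        is literally an estimate at \<open>w\<close>, so uniform convergence carries over to
        \<open>V\<close>.\<close>
      define \<sigma> where "\<sigma> w = (SOME y. y \<in> ball x e \<and> sphere_map g y = w)" for w
      have \<sigma>: "\<sigma> w \<in> ball x e \<and> sphere_map g (\<sigma> w) = w" if "w \<in> V" for w
        unfolding \<sigma>_def by (rule someI_ex) (use that in \<open>auto simp: V_def\<close>)
      have "uniform_limit K (\<lambda>n. \<phi> (s n)) (h \<circ> \<sigma>) sequentially" if "K \<subseteq> V" for K
      proof (rule uniform_limitI)
        fix d :: real assume "d > 0"
        from uniform_limitD[OF lim this]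
        show "\<forall>\<^sub>F n in sequentially. \<forall>w\<in>K. dist (\<phi> (s n) w) ((h \<circ> \<sigma>) w) < d"
        proof eventually_elim
          case (elim n)
          show ?case
          proof
            fix w assume "w \<in> K"
            then have w: "\<sigma> w \<in> cball x e" "sphere_map g (\<sigma> w) = w"
              using \<sigma>[of w] \<open>K \<subseteq> V\<close> by auto
            from elim[rule_format, OF w(1)] show "dist (\<phi> (s n) w) ((h \<circ> \<sigma>) w) < d"
              by (simp add: w(2))
          qed
        qed
      qed
      with s(1) show "\<exists>r h. strict_mono (r :: nat \<Rightarrow> nat) \<and>
          (\<forall>K. compact K \<and> K \<subseteq> V \<longrightarrow> uniform_limit K (\<lambda>n. \<phi> (r n)) h sequentially)"
        by (intro exI[of _ s] exI[of _ "h \<circ> \<sigma>"] conjI allI impI) auto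
    qed
    ultimately show ?thesis unfolding Fatou_def by blast
  qed
  then show ?thesis by (auto simp: Julia_def)
qed

text \<open>Along a suitable sequence in \<^term>\<open>G\<close> every large level avoids the
  boundary of a neighbourhood of \<^term>\<open>J\<close>; being connected, a level set that is not contained in the
  neighbourhood is disjoint from it, and if this always happened the sequence would be normal near a
  point of \<^term>\<open>J\<close>.\<close>

lemma level_near_Julia_component:
  assumes J: "J \<in> Julia_components G" and U: "open U" "Fin -` J \<subseteq> U"
  obtains f R where "f \<in> G" "R > R0" "{z. cmod (poly f z) = R} \<subseteq> U"
proof (rule ccontr)
  assume "\<not> thesis"
  with that have no: "\<not> {z. cmod (poly f z) = R} \<subseteq> U" if "f \<in> G" "R > R0" for f R
    using \<open>f \<in> G\<close> \<open>R > R0\<close> by blast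
  define S where "S = Fin -` Julia G"
  have clS: "closed S" unfolding S_def by (intro closed_vimage_Fin closed_Julia)
  \<comment> \<open>By the Sura-Bura theorem a compact clopen part \<open>K\<close> of the planar
    Julia set fits between the component and \<open>U\<close>, although other components may
    accumulate on \<open>J\<close>.\<close>
  obtain K where K: "openin (top_of_set S) K" "compact K" "Fin -` J \<subseteq> K" "K \<subseteq> U"
    using Sura_Bura_clopen_subset[OF closed_imp_locally_compact[OF clS]
        Julia_component_in_plane[OF J, folded S_def] Julia_component(7)[OF J] U] .
  have KS: "K \<subseteq> S" using K(1) openin_imp_subset by blast
  obtain z0 where z0: "z0 \<in> Fin -` J" using Julia_component(9)[OF J] by blast
  then have "z0 \<in> K" using K by blast
  obtain T where T: "open T" "K = S \<inter> T" using K(1) by (auto simp: openin_open)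
  have "closed ((S - K) \<union> - U)"
  proof -
    have "S - K = S \<inter> - T" using T by auto
    then show ?thesis using clS T(1) U(1) by (auto intro!: closed_Un closed_Int)
  qed
  then obtain d where d: "d > 0" "\<And>x y. \<lbrakk>x \<in> K; y \<in> (S - K) \<union> - U\<rbrakk> \<Longrightarrow> d \<le> dist x y"
    using separate_compact_closed[OF K(2), of "(S - K) \<union> - U"] K(4) by blast
  \<comment> \<open>\<open>K\<close> has distance at least \<open>d\<close> from the rest of the
    Julia set and from the complement of \<open>U\<close>. Hence \<open>N\<close> lies in
    \<open>U\<close>, and \<open>L\<close>, at half that distance, avoids the Julia set.\<close>
  define N where "N = {z. infdist z K < d / 2}"
  define L where "L = {z. infdist z K = d / 2}"
  have far: "infdist y K \<ge> d" if "y \<in> (S - K) \<union> - U" for y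
  proof -
    obtain x where "x \<in> K" "infdist y K = dist y x"
      using infdist_attains_inf[OF compact_imp_closed[OF K(2)]] \<open>z0 \<in> K\<close> by blast
    then show ?thesis using d(2)[OF _ that, of x] by (simp add: dist_commute)
  qed
  have NU: "N \<subseteq> U" using far d(1) by (force simp: N_def)
  have LS: "L \<inter> S = {}"
  proof -
    have "z \<notin> S" if "z \<in> L" for z
      using that far[of z] d(1) infdist_zero[of z K] by (cases "z \<in> K") (auto simp: L_def)
    then show ?thesis by blast
  qed
  have "compact L"
  proof -
    have "closed L" unfolding L_def by (intro closed_Collect_eq continuous_intros)
    moreover have "compact {x. infdist x K \<le> d / 2}"
      using compact_infdist_le[of K "d / 2"] K(2) \<open>z0 \<in> K\<close> d(1) by auto
    moreover have "L = L \<inter> {x. infdist x K \<le> d / 2}" by (auto simp: L_def)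
    ultimately show ?thesis by (metis closed_Int_compact)
  qed
  have split: "C \<subseteq> N \<or> C \<inter> N = {}" if "connected C" "C \<inter> L = {}" for C
  proof -
    have "open N" unfolding N_def by (intro open_Collect_less continuous_intros)
    moreover have "open {z. d / 2 < infdist z K}" by (intro open_Collect_less continuous_intros)
    moreover have "C \<subseteq> N \<union> {z. d / 2 < infdist z K}" using that(2) by (force simp: N_def L_def)
    moreover have "N \<inter> {z. d / 2 < infdist z K} \<inter> C = {}" by (auto simp: N_def)
    ultimately have "N \<inter> C = {} \<or> {z. d / 2 < infdist z K} \<inter> C = {}"
      using connectedD[OF that(1)] by blast
    then show ?thesis using \<open>C \<subseteq> N \<union> {z. d / 2 < infdist z K}\<close> by blast
  qed
  define B where "B = ball z0 (d / 2)"
  have BN: "B \<subseteq> N"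
  proof
    fix x assume "x \<in> B"
    then show "x \<in> N" using infdist_le[OF \<open>z0 \<in> K\<close>, of x] by (simp add: B_def N_def dist_commute)
  qed
  have "Fin z0 \<in> Julia G" using z0 Julia_component(6)[OF J] by blast
  then obtain f where f: "range f \<subseteq> G" "\<not> subconverges_on f B"
    unfolding B_def using Julia_not_subconverges[of z0 G "d / 2"] d(1) by auto
  have "Fin ` L \<subseteq> Fatou G" using LS by (auto simp: S_def Julia_def)
  then obtain s where s: "strict_mono (s :: nat \<Rightarrow> nat)" "avoids_levels (f \<circ> s) L"
    using Fatou_avoids_levels[OF \<open>compact L\<close> _ f(1) deg] by blast
  define F where "F = f \<circ> s"
  have FG: "F n \<in> G" for n using f(1) by (auto simp: F_def)
  have nsub: "\<not> subconverges_on F B"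
    using subconverges_on_subseq[OF _ s(1), of f B] f(2) by (auto simp: F_def)
  obtain M1 where M1: "\<And>R. R > M1 \<Longrightarrow> \<forall>\<^sub>F n in sequentially. \<forall>z\<in>L. cmod (poly (F n) z) \<noteq> R"
    using s(2) unfolding avoids_levels_def F_def by blast
  \<comment> \<open>Above \<open>R1\<close> a level is eventually avoided on \<open>L\<close>, its
    level sets are connected, and the negated conclusion applies.\<close>
  define R1 where "R1 = max (max M1 M) R0"
  have ne: "\<forall>\<^sub>F n in sequentially. \<forall>z\<in>B. cmod (poly (F n) z) \<noteq> R" if "R > R1" for R
  proof -
    have R: "R > M1" "R \<ge> M" "R > R0" using that by (auto simp: R1_def)
    from M1[OF R(1)] show ?thesis
    proof eventually_elim
      case (elim n)
      have "connected {z. cmod (poly (F n) z) = R}" using connected_G_level[OF FG R(2)] .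
      moreover have "{z. cmod (poly (F n) z) = R} \<inter> L = {}" using elim by blast
      moreover have "\<not> {z. cmod (poly (F n) z) = R} \<subseteq> N" using no[OF FG R(3)] NU by blast
      ultimately have "{z. cmod (poly (F n) z) = R} \<inter> N = {}" using split by blast
      then show ?case using BN by blast
    qed
  qed
  have alt: "(\<forall>z\<in>B. cmod (poly p z) \<le> R) \<or> (\<forall>z\<in>B. R \<le> cmod (poly p z))"
    if "\<forall>z\<in>B. cmod (poly p z) \<noteq> R" for p R
  proof (rule ccontr)
    assume "\<not> ?thesis"
    then obtain x y where xy: "x \<in> B" "y \<in> B" "R < cmod (poly p x)" "cmod (poly p y) < R"
      by (auto simp: not_le)
    have "connected ((\<lambda>z. cmod (poly p z)) ` B)"
      unfolding B_def by (intro connected_continuous_image continuous_intros connected_ball)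
    then have "R \<in> (\<lambda>z. cmod (poly p z)) ` B"
      using xy connectedD_interval[of _ "cmod (poly p y)" "cmod (poly p x)" R] by auto
    then show False using that by auto
  qed
  \<comment> \<open>Staying below \<open>R\<close> infinitely often would give a convergent
    subsequence by Montel's theorem. So the sequence exceeds every large \<open>R\<close> on
    \<open>B\<close>, and then it converges to infinity, which is impossible too.\<close>
  have "\<forall>\<^sub>F n in sequentially. \<forall>z\<in>B. R \<le> cmod (poly (F n) z)" if "R > R1" for R
  proof -
    have "\<not> (\<exists>\<^sub>F n in sequentially. \<forall>z\<in>B. cmod (poly (F n) z) \<le> R)"
      using subconverges_if_bounded[of z0 "d / 2" F R] nsub by (auto simp: B_def)
    then have "\<forall>\<^sub>F n in sequentially. \<not> (\<forall>z\<in>B. cmod (poly (F n) z) \<le> R)"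
      by (simp add: not_frequently)
    with ne[OF that] show ?thesis by eventually_elim (use alt in blast)
  qed
  then have "subconverges_on F B" by (rule subconverges_if_large)
  with nsub show False by blast
qed

text \<open>Otherwise a closed connected \<open>T\<close> missing \<open>J\<close> joins the
  critical value to infinity. Every \<open>f\<close> in \<open>G\<close> has modulus below
  \<open>M\<close> at the critical value and is large far out, so each level above \<open>M\<close>
  meets \<open>T\<close>; but some such level set lies close to \<open>J\<close>.\<close>

lemma critical_value_not_outside:
  assumes J: "J \<in> Julia_components G" and g: "g \<in> G" and c: "poly (pderiv g) c = 0"
  shows "poly g c \<notin> outside (Fin -` J)"
proof
  define p K where "p = poly g c" and "K = Fin -` J"
  assume "poly g c \<in> outside (Fin -` J)"
  then have out: "p \<notin> K" "\<not> bounded (connected_component_set (- K) p)"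
    by (auto simp: outside_def p_def K_def)
  have "compact K" unfolding K_def by (rule Julia_component(7)[OF J])
  then obtain B where B: "B > 0" "K \<subseteq> ball 0 B"
    using bounded_subset_ballD[OF compact_imp_bounded, of K 0] by blast
  obtain q where q: "q \<in> connected_component_set (- K) p" "q \<notin> ball 0 B"
    using out(2) bounded_subset[OF bounded_ball] by blast
  have "open (- K)" using \<open>compact K\<close> compact_imp_closed by blast
  then have "path_component (- K) p q"
    using q(1) by (simp add: open_path_connected_component)
  then obtain \<gamma> where \<gamma>: "path \<gamma>" "path_image \<gamma> \<subseteq> - K" "pathstart \<gamma> = p" "pathfinish \<gamma> = q"
    by (auto simp: path_component_def)
  define T where "T = path_image \<gamma> \<union> (- ball 0 B)"
  have "closed T" unfolding T_def using \<gamma>(1) by (intro closed_Un closed_path_image) (auto simp: closed_Compl)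
  have "connected T" unfolding T_def
  proof (rule connected_Un)
    show "connected (path_image \<gamma>)" using \<gamma>(1) by (rule connected_path_image)
    show "connected (- ball (0::complex) B)" by (intro connected_complement_bounded_convex) auto
    show "path_image \<gamma> \<inter> - ball 0 B \<noteq> {}" using q(2) \<gamma>(4) pathfinish_in_path_image[of \<gamma>] by auto
  qed
  have TK: "K \<subseteq> - T" using \<gamma>(2) B(2) by (auto simp: T_def)
  obtain f R where f: "f \<in> G" "R > M" "{z. cmod (poly f z) = R} \<subseteq> - T"
    using level_near_Julia_component[OF J open_Compl[OF \<open>closed T\<close>] TK[unfolded K_def]] .
  obtain r where r: "\<forall>z. r \<le> cmod z \<longrightarrow> R + 1 \<le> cmod (poly f z)" using poly_large[OF deg[OF f(1)]] by blast
  define w :: complex where "w = of_real (max r B)"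
  have "w \<in> T" using B(1) by (auto simp: w_def T_def)
  moreover have "R < cmod (poly f w)"
  proof -
    have "r \<le> cmod w" using B(1) by (auto simp: w_def)
    then show ?thesis using r by force
  qed
  moreover have "p \<in> T" using \<gamma>(3) pathstart_in_path_image[of \<gamma>] by (auto simp: T_def)
  moreover have "cmod (poly f p) < R" using crit_image[OF f(1) g c] f(2) by (simp add: p_def)
  moreover have "connected ((\<lambda>z. cmod (poly f z)) ` T)"
    by (intro connected_continuous_image continuous_intros \<open>connected T\<close>)
  ultimately have "R \<in> (\<lambda>z. cmod (poly f z)) ` T"
    using connectedD_interval[of _ "cmod (poly f p)" "cmod (poly f w)" R] by auto
  then show False using f(3) by auto
qed

section \<open>Total ordering of the bounded Julia components\<close>

text \<open>If each lay outside the other, a finite critical value would lie in both filled sets.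
  The filled set \<open>H\<close> of the first is connected and misses \<open>K2\<close>, yet would
  meet both the inside and the outside of \<open>K2\<close>.\<close>

lemma Julia_components_nested:
  assumes J: "J1 \<in> Julia_components G" "J2 \<in> Julia_components G" "J1 \<noteq> J2"
  shows "Fin -` J1 \<subseteq> inside (Fin -` J2) \<or> Fin -` J2 \<subseteq> inside (Fin -` J1)"
proof -
  define K1 K2 where "K1 = Fin -` J1" and "K2 = Fin -` J2"
  have K: "connected K1" "connected K2" "closed K1" "closed K2"
    using Julia_component(7,8)[OF J(1)] Julia_component(7,8)[OF J(2)] compact_imp_closed
    by (auto simp: K1_def K2_def)
  have "J1 \<inter> J2 = {}"
    using components_disjoint[OF Julia_component(1)[OF J(1)] Julia_component(1)[OF J(2)] J(3)] .
  then have disj: "K1 \<inter> K2 = {}" by (auto simp: K1_def K2_def)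
  have dich: "A \<subseteq> inside B \<or> A \<subseteq> outside B" if "connected A" "A \<inter> B = {}" for A B :: "complex set"
  proof -
    have "A \<subseteq> inside B \<union> outside B" using that(2) by (auto simp: inside_Un_outside)
    moreover have "inside B \<inter> A = {} \<or> outside B \<inter> A = {}"
      using inside_outside_intersect_connected[OF that(1), of B] that(2) by blast
    ultimately show ?thesis by blast
  qed
  show ?thesis
  proof (rule ccontr)
    assume "\<not> ?thesis"
    then have out: "K1 \<subseteq> outside K2" "K2 \<subseteq> outside K1"
      using dich[OF K(1), of K2] dich[OF K(2), of K1] disj by (auto simp: K1_def K2_def)
    \<comment> \<open>Applied to the whole plane, the level set lemma shows that \<open>G\<close> is
      non-empty. The degree bound then gives \<open>g\<close> a finite critical point.\<close>
    obtain g where g: "g \<in> G"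
      using level_near_Julia_component[OF J(1) open_UNIV subset_UNIV] by blast
    have "degree (pderiv g) > 0" using deg_ge_2[OF g] by (simp add: degree_pderiv)
    then obtain c where c: "poly (pderiv g) c = 0" using surj_poly by blast
    have p: "poly g c \<in> K1 \<union> inside K1" "poly g c \<in> K2 \<union> inside K2"
      using critical_value_not_outside[OF J(1) g c] critical_value_not_outside[OF J(2) g c]
        inside_Un_outside[of K1] inside_Un_outside[of K2] unfolding K1_def K2_def by blast+
    define H where "H = K1 \<union> inside K1"
    have "connected H" unfolding H_def by (rule connected_with_inside[OF K(3,1)])
    have HK: "K2 \<inter> H = {}" using out(2) disj inside_Int_outside[of K1] unfolding H_def by blast
    then have "poly g c \<in> inside K2" using p by (auto simp: H_def)
    then have "inside K2 \<inter> H \<noteq> {}" using p(1) by (auto simp: H_def)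
    moreover have "outside K2 \<inter> H \<noteq> {}"
      using out(1) Julia_component(9)[OF J(1)] by (auto simp: H_def K1_def)
    ultimately show False using inside_outside_intersect_connected[OF \<open>connected H\<close>] HK by blast
  qed
qed

lemma total_surrounding_le:
  assumes "J1 \<in> Julia_components G" "J2 \<in> Julia_components G"
  shows "surrounding_le J1 J2 \<or> surrounding_le J2 J1"
proof (cases "J1 = J2")
  case False
  then show ?thesis
    using Julia_components_nested[OF assms] surrounding_le_iff_inside[OF Julia_component(2,5,3)]
      assms by blast
qed (simp add: surrounding_le_def)

lemma surrounding_le_Julia_iff:
  assumes "J1 \<in> Julia_components G"
  shows "surrounding_le J1 J2 \<longleftrightarrow> J1 = J2 \<or> Fin -` J1 \<subseteq> inside (Fin -` J2)"
  using surrounding_le_iff_inside[OF Julia_component(2,5,3)[OF assms]] .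

lemma inside_subset_inside:
  assumes "J1 \<in> Julia_components G" "J2 \<in> Julia_components G" "Fin -` J1 \<subseteq> inside (Fin -` J2)"
  shows "inside (Fin -` J1) \<subseteq> inside (Fin -` J2)"
  using inside_inside_compact_connected[OF compact_imp_closed[OF Julia_component(7)[OF assms(1)]]
      Julia_component(7,8)[OF assms(2)] assms(3)] .

lemma not_mutually_inside:
  assumes J: "J1 \<in> Julia_components G" "J2 \<in> Julia_components G" "Fin -` J1 \<subseteq> inside (Fin -` J2)"
  shows "\<not> Fin -` J2 \<subseteq> inside (Fin -` J1)"
proof
  assume "Fin -` J2 \<subseteq> inside (Fin -` J1)"
  then have "Fin -` J1 \<subseteq> inside (Fin -` J1)"
    using inside_subset_inside[OF J(2,1)] J(3) by blast
  then show False using inside_no_overlap[of "Fin -` J1"] Julia_component(9)[OF J(1)] by blast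
qed

lemma linear_order_surrounding_le:
  "linear_order_on (Julia_components G)
     {(J1, J2). J1 \<in> Julia_components G \<and> J2 \<in> Julia_components G \<and> surrounding_le J1 J2}"
    (is "linear_order_on ?A ?r")
  unfolding linear_order_on_def partial_order_on_def preorder_on_def
proof (intro conjI)
  show "?r \<subseteq> ?A \<times> ?A" by auto
  show "refl_on ?A ?r" by (auto simp: refl_on_def surrounding_le_def)
  show "trans ?r"
  proof (rule transI, clarify)
    fix J1 J2 J3 assume J: "J1 \<in> ?A" "J2 \<in> ?A" "J3 \<in> ?A" "surrounding_le J1 J2" "surrounding_le J2 J3"
    have "J1 = J2 \<or> Fin -` J1 \<subseteq> inside (Fin -` J2)" "J2 = J3 \<or> Fin -` J2 \<subseteq> inside (Fin -` J3)"
      using J surrounding_le_Julia_iff by blast+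
    then have "J1 = J3 \<or> Fin -` J1 \<subseteq> inside (Fin -` J3)"
      using inside_subset_inside[OF J(2,3)] by blast
    then show "surrounding_le J1 J3" using surrounding_le_Julia_iff[OF J(1)] by blast
  qed
  show "antisym ?r"
  proof (rule antisymI, clarify)
    fix J1 J2 assume J: "J1 \<in> ?A" "J2 \<in> ?A" "surrounding_le J1 J2" "surrounding_le J2 J1"
    then show "J1 = J2"
      using surrounding_le_Julia_iff[OF J(1), of J2] surrounding_le_Julia_iff[OF J(2), of J1]
        not_mutually_inside[OF J(1,2)] by blast
  qed
  show "total_on ?A ?r" using total_surrounding_le by (auto simp: total_on_def)
qed

section \<open>Preimages of Julia components\<close>

text \<open>Each clopen piece maps onto \<open>K\<close>, and \<open>Infty\<close> has no preimage
  but itself, so all pieces share the point \<open>Infty\<close>.\<close>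

lemma connected_vimage_if_Infty:
  assumes g: "g \<in> G" and K: "connected K" "closed K" "Infty \<in> K"
  shows "connected (sphere_map g -` K)"
proof (rule connected_if_pieces_meet[of "{Infty}"])
  show "{Infty} \<subseteq> sphere_map g -` K" using K(3) deg[OF g] by simp
  fix A assume A: "openin (top_of_set (sphere_map g -` K)) A" "closedin (top_of_set (sphere_map g -` K)) A" "A \<noteq> {}"
  have "sphere_map g ` A = K" by (rule sphere_map_clopen_piece[OF deg[OF g] K(1,2) A])
  then obtain x where "x \<in> A" "sphere_map g x = Infty" using K(3) by (metis imageE)
  then show "A \<inter> {Infty} \<noteq> {}" by (cases x) auto
qed simp

text \<open>A further point would force \<open>C\<close> to cross the circle of radius
  \<open>R\<close> at some \<open>v\<close>. The preimage of \<open>C\<close> under \<open>f\<close>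
  is connected and contains \<open>Infty\<close>, so it lies in \<open>C\<close>; a preimage of
  \<open>v\<close> is then both in \<open>C\<close> and on a level set chosen near \<open>J\<close>,
  away from \<open>C\<close>.\<close>

lemma Infty_component_trivial:
  assumes J: "J \<in> Julia_components G" and C: "C \<in> components (Julia G)" "Infty \<in> C"
  shows "C = {Infty}"
proof (rule ccontr)
  assume "C \<noteq> {Infty}"
  then obtain x where "x \<in> C" "x \<noteq> Infty" using C(2) by blast
  then obtain w where w: "Fin w \<in> C" by (cases x) auto
  have clC: "closed C" "connected C" "C \<subseteq> Julia G"
    using closed_components[OF closed_Julia C(1)] in_components_connected[OF C(1)] in_components_subset[OF C(1)] by auto
  have "J \<noteq> C" using C(2) Julia_component(2)[OF J] by (auto simp: range_Fin)
  then have "J \<inter> C = {}" using components_disjoint[OF Julia_component(1)[OF J] C(1)] by simp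
  then have JC: "Fin -` J \<subseteq> - (Fin -` C)" by auto
  obtain f R where f: "f \<in> G" "R > cmod w" "{z. cmod (poly f z) = R} \<subseteq> - (Fin -` C)"
    using level_near_Julia_component[OF J open_Compl[OF closed_vimage_Fin[OF clC(1)]] JC] .
  have "\<exists>v. cmod v = R \<and> Fin v \<in> C"
  proof (rule ccontr)
    assume nv: "\<nexists>v. cmod v = R \<and> Fin v \<in> C"
    have "C \<subseteq> Fin ` ball 0 R \<union> insert Infty (Fin ` {z. R < cmod z})"
    proof
      fix x assume "x \<in> C"
      then show "x \<in> Fin ` ball 0 R \<union> insert Infty (Fin ` {z. R < cmod z})"
        using nv by (cases x) (force simp: neq_iff)+
    qed
    moreover have "Fin ` ball 0 R \<inter> insert Infty (Fin ` {z. R < cmod z}) \<inter> C = {}" by auto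
    moreover have "Fin ` ball 0 R \<inter> C \<noteq> {}" using w f(2) by force
    moreover have "insert Infty (Fin ` {z. R < cmod z}) \<inter> C \<noteq> {}" using C(2) by blast
    ultimately show False
      using connectedD[OF clC(2) open_Fin_image[OF open_ball] open_Infty_nhd, of 0 R R] by blast
  qed
  then obtain v where v: "cmod v = R" "Fin v \<in> C" by blast
  obtain u where u: "poly f u = v" using surj_poly[OF deg[OF f(1)]] by blast
  have "sphere_map f -` C \<subseteq> C"
  proof (rule component_absorbs[OF C(1) connected_vimage_if_Infty[OF f(1) clC(2,1) C(2)]])
    show "sphere_map f -` C \<subseteq> Julia G" using Julia_backward_invariant[OF f(1)] clC(3) by blast
    show "C \<inter> sphere_map f -` C \<noteq> {}" using C(2) deg[OF f(1)] by auto
  qed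
  then have "Fin u \<in> C" using u v(2) by auto
  then show False using f(3) u v(1) by auto
qed

lemma connected_vimage_Julia_component:
  assumes g: "g \<in> G" and J: "J \<in> Julia_components G"
  shows "connected (sphere_map g -` J)"
proof (rule ccontr)
  note dg = deg[OF g]
  define X where "X = sphere_map g -` J"
  have clX: "closed X"
    using open_sphere_map_vimage[OF dg, of "- J"] Julia_component(4)[OF J]
    by (simp add: closed_def vimage_Compl X_def)
  have Xr: "X \<subseteq> range Fin" unfolding X_def by (rule sphere_map_vimage_subset_range[OF dg Julia_component(2)[OF J]])
  assume "\<not> connected (sphere_map g -` J)"
  then obtain A where A: "openin (top_of_set X) A" "closedin (top_of_set X) A" "A \<noteq> {}" "A \<noteq> X"
    unfolding X_def connected_clopen by blast
  define B where "B = X - A"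
  have B: "openin (top_of_set X) B" "closedin (top_of_set X) B" "B \<noteq> {}"
    using A openin_imp_subset[OF A(1)] by (auto simp: B_def openin_diff closedin_diff)
  have im: "sphere_map g ` A = J" "sphere_map g ` B = J"
    using sphere_map_clopen_piece[OF dg Julia_component(5,4)[OF J]] A B by (auto simp: X_def)
  have AX: "A \<subseteq> X" using openin_imp_subset[OF A(1)] .
  have "closed A" "closed B" using A(2) B(2) clX closedin_closed_trans by blast+
  then obtain NA NB where N: "open NA" "open NB" "Fin -` A \<subseteq> NA" "Fin -` B \<subseteq> NB" "NA \<inter> NB = {}"
    using separation_normal[of "Fin -` A" "Fin -` B"] closed_vimage_Fin by (auto simp: B_def)
  \<comment> \<open>Points of \<open>U\<close> have all their preimages in \<open>NA\<close> or
    \<open>NB\<close>, and at least one in each. Both pieces map onto \<open>J\<close>, so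
    \<open>U\<close> is a neighbourhood of \<open>J\<close>.\<close>
  define U where "U = - poly g ` (- (NA \<union> NB)) \<inter> poly g ` NA \<inter> poly g ` NB"
  have "open U" unfolding U_def
    using N(1,2) by (intro open_Int open_Compl closed_poly_image poly_open_map dg) (auto simp: closed_Compl)
  have JU: "Fin -` J \<subseteq> U"
  proof
    fix y assume y: "y \<in> Fin -` J"
    have lift: "y \<in> poly g ` (Fin -` D)" if D: "sphere_map g ` D = J" "D \<subseteq> X" for D
    proof -
      have "Fin y \<in> sphere_map g ` D" using y D(1) by simp
      then obtain x where x: "x \<in> D" "Fin y = sphere_map g x" by (rule imageE)
      then obtain z where "x = Fin z" using Xr D(2) by blast
      then show ?thesis using x by auto
    qed
    have "y \<in> poly g ` NA" using lift[OF im(1) AX] N(3) by blast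
    moreover have "y \<in> poly g ` NB" using lift[OF im(2)] N(4) by (auto simp: B_def)
    moreover have "z \<in> NA \<union> NB" if "poly g z = y" for z
    proof -
      have "Fin z \<in> X" using y that by (simp add: X_def)
      then have "Fin z \<in> A \<or> Fin z \<in> B" by (auto simp: B_def)
      then show ?thesis using N(3,4) by auto
    qed
    ultimately show "y \<in> U" unfolding U_def by blast
  qed
  obtain f R where f: "f \<in> G" "R > M" "{z. cmod (poly f z) = R} \<subseteq> U"
    using level_near_Julia_component[OF J \<open>open U\<close> JU] .
  \<comment> \<open>The preimage under \<open>g\<close> of the level set of \<open>f\<close> is a
    level set of an element of \<open>G\<close>, hence connected, yet it is split by
    \<open>NA\<close> and \<open>NB\<close>.\<close>
  define L where "L = {z. cmod (poly (pcompose f g) z) = R}"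
  have "connected L" unfolding L_def using connected_G_level[OF comp[OF f(1) g]] f(2) by simp
  have LN: "L \<subseteq> NA \<union> NB"
  proof
    fix z assume "z \<in> L"
    then have "poly g z \<in> U" using f(3) by (auto simp: L_def poly_pcompose)
    then show "z \<in> NA \<union> NB" by (auto simp: U_def)
  qed
  obtain y where y: "poly f y = of_real R" using surj_poly[OF deg[OF f(1)]] by blast
  then have "cmod (poly f y) = R" using f(2) M_pos by simp
  then have "y \<in> U" using f(3) by blast
  then obtain a b where "a \<in> NA" "poly g a = y" "b \<in> NB" "poly g b = y" by (auto simp: U_def)
  then have "a \<in> NA \<inter> L" "b \<in> NB \<inter> L" using \<open>cmod (poly f y) = R\<close> by (auto simp: L_def poly_pcompose)
  then show False using connectedD[OF \<open>connected L\<close> N(1,2)] N(5) LN by blast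
qed

lemma connected_vimage_component:
  assumes g: "g \<in> G" and J: "J \<in> components (Julia G)"
  shows "connected (sphere_map g -` J)"
proof (cases "Infty \<in> J")
  case True
  then show ?thesis
    using connected_vimage_if_Infty[OF g in_components_connected[OF J] closed_components[OF closed_Julia J]] by blast
next
  case False
  then have "J \<in> Julia_components G" using J by (auto simp: Julia_components_def range_Fin)
  then show ?thesis by (rule connected_vimage_Julia_component[OF g])
qed

text \<open>A non-empty connected subset of the Julia set determines its component; this justifies
  the definite description in \<open>pullback_component\<close>.\<close>

lemma vimage_in_unique_component:
  assumes g: "g \<in> G" and J: "J \<in> components (Julia G)"
  shows "\<exists>!C. C \<in> components (Julia G) \<and> sphere_map g -` J \<subseteq> C"
proof -
  have sub: "sphere_map g -` J \<subseteq> Julia G"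
    using Julia_backward_invariant[OF g] in_components_subset[OF J] by blast
  obtain x where x: "x \<in> sphere_map g -` J"
    using in_components_nonempty[OF J] surj_sphere_map[OF deg[OF g]] by (metis ex_in_conv vimageI)
  obtain C where C: "C \<in> components (Julia G)" "sphere_map g -` J \<subseteq> C"
    using exists_component_superset[OF sub _ connected_vimage_component[OF g J]] x sub by blast
  show ?thesis
  proof (rule ex1I[of _ C])
    show "D = C" if "D \<in> components (Julia G) \<and> sphere_map g -` J \<subseteq> D" for D
      using components_disjoint[of D "Julia G" C] that C x by blast
  qed (use C in blast)
qed

text \<open>A component through \<open>Infty\<close> would be just that point, but the preimage of
  \<open>J\<close> is non-empty and finite points only.\<close>

lemma pullback_component:
  assumes g: "g \<in> G" and J: "J \<in> Julia_components G"
  shows "pullback_component G g J \<in> Julia_components G" "sphere_map g -` J \<subseteq> pullback_component G g J"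
proof -
  have P: "pullback_component G g J \<in> components (Julia G) \<and> sphere_map g -` J \<subseteq> pullback_component G g J"
    unfolding pullback_component_def by (rule theI'[OF vimage_in_unique_component[OF g Julia_component(1)[OF J]]])
  then show "sphere_map g -` J \<subseteq> pullback_component G g J" by blast
  have "Infty \<notin> pullback_component G g J"
  proof
    assume "Infty \<in> pullback_component G g J"
    then have "sphere_map g -` J \<subseteq> {Infty}" using Infty_component_trivial[OF J] P by blast
    moreover have "Infty \<notin> sphere_map g -` J"
      using sphere_map_vimage_subset_range[OF deg[OF g] Julia_component(2)[OF J]] by (auto simp: range_Fin)
    ultimately have "sphere_map g -` J = {}" by blast
    then show False
      using Julia_component(3)[OF J] surj_sphere_map[OF deg[OF g]] by (metis ex_in_conv vimageI)
  qed
  then show "pullback_component G g J \<in> Julia_components G"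
    using P by (auto simp: Julia_components_def range_Fin)
qed

text \<open>\<open>g\<close> maps a complementary component of the preimage into one of
  \<open>K\<close>, and the preimage of a bounded set under a polynomial is bounded.\<close>

lemma vimage_inside:
  assumes g: "g \<in> G"
  shows "poly g -` inside K \<subseteq> inside (poly g -` K)"
proof
  fix x assume x: "x \<in> poly g -` inside K"
  define C where "C = connected_component_set (- (poly g -` K)) x"
  have xK: "poly g x \<notin> K" "bounded (connected_component_set (- K) (poly g x))"
    using x by (auto simp: inside_def)
  have "x \<in> C" using xK by (simp add: C_def)
  have "poly g ` C \<subseteq> connected_component_set (- K) (poly g x)"
  proof (rule connected_component_maximal)
    show "connected (poly g ` C)"
      unfolding C_def by (intro connected_continuous_image continuous_intros connected_connected_component)
    show "poly g ` C \<subseteq> - K" using connected_component_subset[of "- (poly g -` K)" x] by (auto simp: C_def)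
  qed (use \<open>x \<in> C\<close> in blast)
  then have "C \<subseteq> poly g -` connected_component_set (- K) (poly g x)" by blast
  then have "bounded C" using bounded_vimage_poly[OF deg[OF g] xK(2)] bounded_subset by blast
  then show "x \<in> inside (poly g -` K)" using xK by (simp add: inside_def C_def)
qed

lemma surrounding_le_vimage:
  assumes g: "g \<in> G" and J: "J1 \<in> Julia_components G" "J2 \<in> Julia_components G" and le: "surrounding_le J1 J2"
  shows "surrounding_le (sphere_map g -` J1) (sphere_map g -` J2)"
    "surrounding_le (pullback_component G g J1) (pullback_component G g J2)"
proof -
  let ?A1 = "pullback_component G g J1" and ?A2 = "pullback_component G g J2"
  note A1 = pullback_component[OF g J(1)] and A2 = pullback_component[OF g J(2)]
  have ne: "sphere_map g -` J1 \<noteq> {}"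
    using Julia_component(3)[OF J(1)] surj_sphere_map[OF deg[OF g]] by (metis ex_in_conv vimageI)
  have iff: "surrounding_le (sphere_map g -` J1) (sphere_map g -` J2) \<longleftrightarrow>
      sphere_map g -` J1 = sphere_map g -` J2 \<or> poly g -` (Fin -` J1) \<subseteq> inside (poly g -` (Fin -` J2))"
    using surrounding_le_iff_inside[OF sphere_map_vimage_subset_range[OF deg[OF g] Julia_component(2)[OF J(1)]]
        connected_vimage_Julia_component[OF g J(1)] ne] by simp
  have cases: "J1 = J2 \<or> Fin -` J1 \<subseteq> inside (Fin -` J2)"
    using le surrounding_le_Julia_iff[OF J(1)] by blast
  have sub: "poly g -` (Fin -` J1) \<subseteq> inside (poly g -` (Fin -` J2))" if "J1 \<noteq> J2"
  proof -
    have "poly g -` (Fin -` J1) \<subseteq> poly g -` inside (Fin -` J2)" using cases that by blast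
    then show ?thesis using vimage_inside[OF g] by blast
  qed
  then show "surrounding_le (sphere_map g -` J1) (sphere_map g -` J2)" unfolding iff by blast
  show "surrounding_le ?A1 ?A2"
  \<comment> \<open>If the order were reversed, a point \<open>z\<close> over \<open>J1\<close>
    would lie inside the preimage of \<open>J2\<close>, hence inside \<open>?A2\<close>, hence
    inside \<open>?A1\<close>, although it belongs to \<open>?A1\<close>.\<close>
  proof (rule ccontr)
    assume nle: "\<not> surrounding_le ?A1 ?A2"
    then have "?A1 \<noteq> ?A2" "J1 \<noteq> J2" by (auto simp: surrounding_le_def)
    have in21: "Fin -` ?A2 \<subseteq> inside (Fin -` ?A1)"
      using Julia_components_nested[OF A1(1) A2(1) \<open>?A1 \<noteq> ?A2\<close>] nle surrounding_le_Julia_iff[OF A1(1)] by blast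
    have "?A1 \<inter> ?A2 = {}"
      using components_disjoint[OF Julia_component(1)[OF A1(1)] Julia_component(1)[OF A2(1)] \<open>?A1 \<noteq> ?A2\<close>] .
    obtain z where z: "z \<in> poly g -` (Fin -` J1)"
      using ne sphere_map_vimage_subset_range[OF deg[OF g] Julia_component(2)[OF J(1)]] by fastforce
    then have zA1: "z \<in> Fin -` ?A1" using A1(2) by auto
    have "poly g -` (Fin -` J2) \<subseteq> Fin -` ?A2" using vimage_mono[OF A2(2), of Fin] by simp
    then have "inside (poly g -` (Fin -` J2)) - Fin -` ?A2 \<subseteq> inside (Fin -` ?A2)" by (rule inside_mono)
    moreover have "z \<in> inside (poly g -` (Fin -` J2))" using sub[OF \<open>J1 \<noteq> J2\<close>] z by blast
    moreover have "z \<notin> Fin -` ?A2" using zA1 \<open>?A1 \<inter> ?A2 = {}\<close> by auto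
    ultimately have "z \<in> inside (Fin -` ?A1)" using inside_subset_inside[OF A2(1) A1(1) in21] by blast
    then show False using zA1 inside_no_overlap[of "Fin -` ?A1"] by blast
  qed
qed

section \<open>Connectivity of Fatou components\<close>

text \<open>Without Julia points \<open>K\<close> would equal another Fatou component and be clopen
  in the connected sphere. The Julia component of any Julia point of \<open>K\<close> avoids
  \<open>U\<close>, so it stays in \<open>K\<close>.\<close>

lemma Julia_component_in_complementary_component:
  assumes U: "U \<in> components (Fatou G)" and K: "K \<in> components (- U)" "Infty \<notin> K"
  obtains J where "J \<in> Julia_components G" "J \<subseteq> K"
proof -
  have op: "open U" using open_components_sphere[OF open_Fatou U] .
  have conK: "connected K" "K \<subseteq> - U" "K \<noteq> {}"
    using in_components_connected[OF K(1)] in_components_subset[OF K(1)] in_components_nonempty[OF K(1)] by auto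
  have "K \<inter> Julia G \<noteq> {}"
  proof
    assume "K \<inter> Julia G = {}"
    then have "K \<subseteq> Fatou G" by (auto simp: Julia_def)
    then obtain U' where U': "U' \<in> components (Fatou G)" "K \<subseteq> U'"
      using exists_component_superset[of K "Fatou G"] conK by blast
    have "U' \<noteq> U" using U'(2) conK by blast
    then have "U' \<subseteq> - U" using components_disjoint[OF U'(1) U] by blast
    then have "U' \<subseteq> K"
      using component_absorbs[OF K(1) in_components_connected[OF U'(1)]] U'(2) conK(3) by blast
    then have "open K" using U' open_components_sphere[OF open_Fatou U'(1)] by auto
    moreover have "closed K" using closed_components[OF _ K(1)] op by (simp add: closed_Compl)
    ultimately have "K = {} \<or> K = UNIV"
      using connected_sphere_UNIV by (auto simp: connected_clopen)
    then have "U = {}" using conK by auto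
    then show False using in_components_nonempty[OF U] by blast
  qed
  then obtain x where x: "x \<in> K" "x \<in> Julia G" by blast
  define J where "J = connected_component_set (Julia G) x"
  have J: "J \<in> components (Julia G)" using x(2) by (auto simp: J_def components_def)
  have "x \<in> J" using x(2) by (simp add: J_def)
  have "J \<subseteq> - U"
    using in_components_subset[OF J] in_components_subset[OF U] by (auto simp: Julia_def)
  then have "J \<subseteq> K"
    using component_absorbs[OF K(1) in_components_connected[OF J]] \<open>x \<in> J\<close> x(1) by blast
  moreover have "J \<in> Julia_components G"
    using J K(2) \<open>J \<subseteq> K\<close> by (auto simp: Julia_components_def range_Fin)
  ultimately show thesis by (rule that[rotated])
qed

text \<open>The complement of \<open>K\<close> is connected, avoids \<open>J2\<close> and contains
  both \<open>J1\<close> and \<open>Infty\<close>, so \<open>J2\<close> cannot separate these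
  two.\<close>

lemma not_inside_disjoint_complementary_component:
  assumes U: "U \<in> components (Fatou G)" and K: "K \<in> components (- U)" "Infty \<notin> K"
    and J: "J1 \<in> Julia_components G" "J2 \<in> Julia_components G" "J2 \<subseteq> K" "J1 \<inter> K = {}"
  shows "\<not> Fin -` J1 \<subseteq> inside (Fin -` J2)"
proof
  define I where "I = inside (Fin -` J2)"
  assume sub: "Fin -` J1 \<subseteq> inside (Fin -` J2)"
  have J2: "compact (Fin -` J2)" using Julia_component(7)[OF J(2)] .
  have "connected (- K)"
    using component_diff_connected[of U UNIV K] K(1) in_components_connected[OF U] connected_sphere_UNIV
    by (simp add: Compl_eq_Diff_UNIV)
  have "open I" unfolding I_def using J2 by (intro open_inside compact_imp_closed)
  then have op1: "open (Fin ` I)" by (rule open_Fin_image)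
  have "closed (Fin -` J2 \<union> I)"
    unfolding I_def union_with_inside using J2 by (simp add: closed_Compl open_outside compact_imp_closed)
  moreover have "bounded (Fin -` J2 \<union> I)"
    unfolding I_def using J2 by (simp add: bounded_inside compact_imp_bounded)
  ultimately have "compact (Fin -` J2 \<union> I)" by (simp only: compact_eq_bounded_closed)
  then have "closed (Fin ` (Fin -` J2 \<union> I))" by (intro compact_imp_closed compact_Fin_image)
  then have op2: "open (- Fin ` (I \<union> Fin -` J2))" by (simp only: open_Compl Un_commute)
  have "- K \<subseteq> Fin ` I \<union> - Fin ` (I \<union> Fin -` J2)" using J(3) by auto
  moreover have "Fin ` I \<inter> - Fin ` (I \<union> Fin -` J2) \<inter> - K = {}" by auto
  moreover have "Fin ` I \<inter> - K \<noteq> {}"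
  proof -
    obtain z where "z \<in> Fin -` J1" using Julia_component(9)[OF J(1)] by blast
    then have "z \<in> I" "Fin z \<notin> K" using sub J(4) by (auto simp: I_def)
    then show ?thesis by blast
  qed
  moreover have "- Fin ` (I \<union> Fin -` J2) \<inter> - K \<noteq> {}" using K(2) by auto
  ultimately show False using connectedD[OF \<open>connected (- K)\<close> op1 op2] by blast
qed

text \<open>Two of them would contain bounded Julia components neither of which surrounds the
  other.\<close>

lemma at_most_one_finite_complementary_component:
  assumes U: "U \<in> components (Fatou G)"
    and K: "K1 \<in> components (- U)" "Infty \<notin> K1" "K2 \<in> components (- U)" "Infty \<notin> K2"
  shows "K1 = K2"
proof (rule ccontr)
  assume "K1 \<noteq> K2"
  then have disj: "K1 \<inter> K2 = {}" using components_disjoint[OF K(1,3)] by simp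
  obtain J1 J2 where J: "J1 \<in> Julia_components G" "J1 \<subseteq> K1" "J2 \<in> Julia_components G" "J2 \<subseteq> K2"
    using Julia_component_in_complementary_component[OF U K(1,2)]
      Julia_component_in_complementary_component[OF U K(3,4)] by metis
  have "J1 \<noteq> J2" using J disj Julia_component(3)[OF J(1)] by blast
  then show False
    using Julia_components_nested[OF J(1,3)] disj J
      not_inside_disjoint_complementary_component[OF U K(1,2) J(3,1,2)]
      not_inside_disjoint_complementary_component[OF U K(3,4) J(1,3,4)] by blast
qed

text \<open>One complementary component at most contains \<open>Infty\<close> and one at most omits
  it, so there are at most two. With fewer than two the complement is connected, possibly
  empty.\<close>

lemma Fatou_component_connectivity:
  assumes U: "U \<in> components (Fatou G)"
  shows "simply_connected U \<or> doubly_connected U"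
proof -
  have U': "open U" "connected U"
    using open_components_sphere[OF open_Fatou U] in_components_connected[OF U] by auto
  show ?thesis
  proof (cases "\<exists>K1 K2. K1 \<in> components (- U) \<and> K2 \<in> components (- U) \<and> K1 \<noteq> K2")
    case False
    have "connected (- U)"
      unfolding connected_iff_eq_connected_component_set
    proof
      fix x assume "x \<in> - U"
      show "connected_component_set (- U) x = - U"
      proof
        show "- U \<subseteq> connected_component_set (- U) x"
        proof
          fix y assume "y \<in> - U"
          then have "connected_component_set (- U) x = connected_component_set (- U) y"
            using False \<open>x \<in> - U\<close> by (metis componentsI)
          moreover have "y \<in> connected_component_set (- U) y" using \<open>y \<in> - U\<close> by simp
          ultimately show "y \<in> connected_component_set (- U) x" by (simp only:)
        qed
      qed (rule connected_component_subset)
    qed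
    then show ?thesis using simply_connected_if_connected_complement[OF U'] by blast
  next
    case True
    then obtain K1 K2 where K: "K1 \<in> components (- U)" "K2 \<in> components (- U)" "K1 \<noteq> K2" by blast
    have "K = K1 \<or> K = K2" if "K \<in> components (- U)" for K
    proof -
      have inf: "A = B" if "A \<in> components (- U)" "B \<in> components (- U)" "Infty \<in> A" "Infty \<in> B" for A B
        using components_disjoint[OF that(1,2)] that(3,4) by blast
      show ?thesis
        using at_most_one_finite_complementary_component[OF U] inf K \<open>K \<in> components (- U)\<close> by metis
    qed
    then have "components (- U) = {K1, K2}" using K by blast
    then have "doubly_connected U" using U' K(3) by (simp add: doubly_connected_def)
    then show ?thesis ..
  qed
qed

end

section \<open>Application to the class of postcritically bounded semigroups\<close>

lemma class_G_bounded_critical_orbits: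
  assumes "G \<in> class_G"
  obtains M where "bounded_critical_orbits G M"
proof -
  have bnd: "bounded (Fin -` finite_postcritical G)"
    using assms by (simp add: class_G_def postcritically_bounded_def)
  obtain B where B: "\<And>z. z \<in> Fin -` finite_postcritical G \<Longrightarrow> cmod z \<le> B"
    using bnd by (auto simp: bounded_iff)
  obtain \<Gamma> where \<Gamma>: "G = generated_semigroup \<Gamma>" using assms by (auto simp: class_G_def polynomial_semigroup_def)
  \<comment> \<open>\<open>max B 0\<close> makes the bound positive and the added 1 makes the
    inequality for critical values strict.\<close>
  have "bounded_critical_orbits G (max B 0 + 1)"
  proof
    show "degree g \<ge> 2" if "g \<in> G" for g using assms that by (simp add: class_G_def)
    show "pcompose f g \<in> G" if "f \<in> G" "g \<in> G" for f g
      using that unfolding \<Gamma> by (rule generated_semigroup.comp)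
    show "cmod (poly g c) < max B 0 + 1" if "g \<in> G" "poly (pderiv g) c = 0" for g c
    proof -
      have "Fin c \<in> critical_points g" using that(2) by (auto simp: critical_points_def)
      then have "sphere_map g (Fin c) \<in> critical_values g" unfolding critical_values_def by (rule imageI)
      then have "Fin (poly g c) \<in> critical_values g" by simp
      then have "Fin (poly g c) \<in> postcritical G"
        unfolding postcritical_def using UN_I[OF that(1)] by (intro subsetD[OF closure_subset])
      then show ?thesis using B[of "poly g c"] by (simp add: finite_postcritical_def)
    qed
  qed simp
  then show thesis by (rule that)
qed

theorem theorem2p7:
  fixes G :: "complex poly set"
  assumes "G \<in> class_G"
  shows
    "linear_order_on (Julia_components G)
       {(J1, J2). J1 \<in> Julia_components G \<and> J2 \<in> Julia_components G \<and> surrounding_le J1 J2}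
     \<and> (\<forall>U \<in> components (Fatou G). simply_connected U \<or> doubly_connected U)
     \<and> (\<forall>g \<in> G.
          (\<forall>J \<in> components (Julia G).
             connected (sphere_map g -` J)
             \<and> (\<exists>!C. C \<in> components (Julia G) \<and> sphere_map g -` J \<subseteq> C))
          \<and> (\<forall>J \<in> Julia_components G. pullback_component G g J \<in> Julia_components G)
          \<and> (\<forall>J1 \<in> Julia_components G. \<forall>J2 \<in> Julia_components G. surrounding_le J1 J2 \<longrightarrow>
               surrounding_le (sphere_map g -` J1) (sphere_map g -` J2)
               \<and> surrounding_le (pullback_component G g J1) (pullback_component G g J2)))"
proof -
  obtain M where "bounded_critical_orbits G M" using class_G_bounded_critical_orbits[OF assms] .
  then interpret bounded_critical_orbits G M .
  show ?thesis
    using linear_order_surrounding_le Fatou_component_connectivity connected_vimage_component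
      vimage_in_unique_component pullback_component(1) surrounding_le_vimage by simp
qed

end
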